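(* Let $\alpha$ be a continuous rotationally symmetric norm on $L^\infty(\mathbb T)$ and let $X$ be a separable Banach space. If $f\in L^\alpha(\mathbb T,X)$ and $g\in L^1(\mathbb T)$, then $f\ast g\in L^\alpha(\mathbb T,X)$ and $\alpha(f\ast g)\le\alpha(f)\|g\|_1$.
   Context: $\mathbb T$ is the unit circle and $m$ is normalized arc length (Haar measure) on $\mathbb T$; functions equal a.e. are identified. For a function $f$ on $\mathbb T$ and $w\in\mathbb T$, $f_w(z)=f(\overline wz)$. A continuous rotationally symmetric norm is a norm $\alpha$ on $L^\infty(\mathbb T)$ with $\alpha(1)=1$, $\alpha(|f|)=\alpha(f)$, $\alpha(f_w)=\alpha(f)$ for all $f\in L^\infty(\mathbb T)$, $w\in\mathbb T$, and $\lim_{m(E)\to0^+}\alpha(\chi_E)=0$. For any measurable $f:\mathbb T\to\mathbb C$ put $\alpha(f)=\sup\{\alpha(s):s\text{ a simple function},\ |s|\le|f|\}$. $\mathcal L^\alpha(\mathbb T)$ is the set of measurable $f$ with $\alpha(f)<\infty$, and $L^\alpha(\mathbb T)$ is the $\alpha$-closure of $L^\infty(\mathbb T)$ in $\mathcal L^\alpha(\mathbb T)$. For $f:\mathbb T\to X$ measurable, $|f|(z)=\|f(z)\|$ and $\alpha(f)=\alpha(|f|)$; $L^\alpha(\mathbb T,X)$ is the Banach space (with norm $\alpha$) of measurable $f:\mathbb T\to X$ with $|f|\in L^\alpha(\mathbb T)$. The convolution is defined for almost every $z\in\mathbb T$ by $(f\ast g)(z)=\int_{\mathbb T}f(\overline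 wz)g(w)\,dm(w)$, where the integral of $X$-valued functions in $L^1(\mathbb T,X)$ is the usual (Bochner) integral. *)

theory Defs
  imports "HOL-Analysis.Analysis"
begin

text \<open>
  Complex Banach spaces. The class \<open>banach\<close> only provides real scalars, but the convolution
  multiplies vectors by complex numbers. Separability is the additional sort
  \<open>second_countable_topology\<close>, which is equivalent to it for metric spaces and which is what the
  Bochner integral of the library requires.
\<close>

class complex_banach = banach +
  fixes scaleC :: "complex \<Rightarrow> 'a \<Rightarrow> 'a" (infixr \<open>*\<^sub>C\<close> 75)
  assumes scaleC_add_right: "a *\<^sub>C (x + y) = a *\<^sub>C x + a *\<^sub>C y"
    and scaleC_add_left: "(a + b) *\<^sub>C x = a *\<^sub>C x + b *\<^sub>C x"
    and scaleC_scaleC: "a *\<^sub>C b *\<^sub>C x = (a * b) *\<^sub>C x"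
    and scaleC_one: "1 *\<^sub>C x = x"
    and scaleC_of_real: "complex_of_real r *\<^sub>C x = r *\<^sub>R x"
    and norm_scaleC: "norm (a *\<^sub>C x) = norm a * norm x"

instantiation complex :: complex_banach
begin

definition scaleC_complex :: "complex \<Rightarrow> complex \<Rightarrow> complex"
  where "scaleC_complex a x = a * x"

instance
  by standard (simp_all add: scaleC_complex_def algebra_simps norm_mult scaleR_conv_of_real)

end

definition circle_measure :: "complex measure"
  where "circle_measure =
    distr (uniform_measure lborel {0..1}) (restrict_space borel (sphere 0 1))
      (\<lambda>t. cis (2 * pi * t))"

definition rotate_fun :: "complex \<Rightarrow> (complex \<Rightarrow> 'a) \<Rightarrow> complex \<Rightarrow> 'a"
  where "rotate_fun w f = (\<lambda>z. f (cnj w * z))"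

text \<open>
  Function spaces are sets of representatives rather than of equivalence classes: whatever depends
  on a function is required, or defined so as, to respect equality almost everywhere. Measurability
  is Borel measurability, since every Lebesgue measurable class has a Borel representative. Values
  outside the unit circle are irrelevant.
\<close>

definition Linfty :: "(complex \<Rightarrow> complex) set"
  where "Linfty = {f \<in> borel_measurable circle_measure.
    \<exists>C. AE z in circle_measure. norm (f z) \<le> C}"

locale continuous_rotationally_symmetric_norm =
  fixes \<alpha> :: "(complex \<Rightarrow> complex) \<Rightarrow> real"
  assumes AE_cong: "\<lbrakk>f \<in> Linfty; g \<in> Linfty; AE z in circle_measure. f z = g z\<rbrakk> \<Longrightarrow> \<alpha> f = \<alpha> g"
    and nonneg: "f \<in> Linfty \<Longrightarrow> 0 \<le> \<alpha> f"
    and eq_zero: "\<lbrakk>f \<in> Linfty; \<alpha> f = 0\<rbrakk> \<Longrightarrow> AE z in circle_measure. f z = 0"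
    and triangle: "\<lbrakk>f \<in> Linfty; g \<in> Linfty\<rbrakk> \<Longrightarrow> \<alpha> (\<lambda>z. f z + g z) \<le> \<alpha> f + \<alpha> g"
    and scale: "f \<in> Linfty \<Longrightarrow> \<alpha> (\<lambda>z. c * f z) = norm c * \<alpha> f"
    and one: "\<alpha> (\<lambda>z. 1) = 1"
    and abs: "f \<in> Linfty \<Longrightarrow> \<alpha> (\<lambda>z. complex_of_real (norm (f z))) = \<alpha> f"
    and rotate: "\<lbrakk>f \<in> Linfty; w \<in> sphere 0 1\<rbrakk> \<Longrightarrow> \<alpha> (rotate_fun w f) = \<alpha> f"
    and continuous: "0 < \<epsilon> \<Longrightarrow> \<exists>\<delta>>0. \<forall>E \<in> sets circle_measure.
      0 < measure circle_measure E \<and> measure circle_measure E < \<delta> \<longrightarrow> \<alpha> (indicator E) < \<epsilon>"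

definition ext_norm ::
    "((complex \<Rightarrow> complex) \<Rightarrow> real) \<Rightarrow> (complex \<Rightarrow> complex) \<Rightarrow> ennreal"
  where "ext_norm \<alpha> f =
    (SUP s \<in> {s. simple_function circle_measure s \<and>
                 (AE z in circle_measure. norm (s z) \<le> norm (f z))}. ennreal (\<alpha> s))"

definition calL_alpha ::
    "((complex \<Rightarrow> complex) \<Rightarrow> real) \<Rightarrow> (complex \<Rightarrow> complex) set"
  where "calL_alpha \<alpha> = {f \<in> borel_measurable circle_measure. ext_norm \<alpha> f < \<infinity>}"

definition L_alpha ::
    "((complex \<Rightarrow> complex) \<Rightarrow> real) \<Rightarrow> (complex \<Rightarrow> complex) set"
  where "L_alpha \<alpha> = {f \<in> calL_alpha \<alpha>.
    \<forall>\<epsilon>>0. \<exists>h \<in> Linfty. ext_norm \<alpha> (\<lambda>z. f z - h z) < \<epsilon>}"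

definition abs_fun :: "(complex \<Rightarrow> 'x::real_normed_vector) \<Rightarrow> complex \<Rightarrow> complex"
  where "abs_fun f = (\<lambda>z. complex_of_real (norm (f z)))"

definition ext_norm_vec ::
    "((complex \<Rightarrow> complex) \<Rightarrow> real) \<Rightarrow> (complex \<Rightarrow> 'x::real_normed_vector) \<Rightarrow> ennreal"
  where "ext_norm_vec \<alpha> f = ext_norm \<alpha> (abs_fun f)"

definition L_alpha_vec ::
    "((complex \<Rightarrow> complex) \<Rightarrow> real) \<Rightarrow> (complex \<Rightarrow> 'x::real_normed_vector) set"
  where "L_alpha_vec \<alpha> = {f \<in> borel_measurable circle_measure. abs_fun f \<in> L_alpha \<alpha>}"

definition convolution_integrand ::
    "(complex \<Rightarrow> 'x::complex_banach) \<Rightarrow> (complex \<Rightarrow> complex) \<Rightarrow> complex \<Rightarrow> complex \<Rightarrow> 'x"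
  where "convolution_integrand f g z = (\<lambda>w. g w *\<^sub>C f (cnj w * z))"

text \<open>The library's integral is \<open>0\<close> at those \<open>z\<close> where the integrand is not integrable.\<close>

definition convolution ::
    "(complex \<Rightarrow> 'x::{complex_banach, second_countable_topology}) \<Rightarrow> (complex \<Rightarrow> complex)
      \<Rightarrow> complex \<Rightarrow> 'x"
  where "convolution f g = (\<lambda>z. \<integral>w. convolution_integrand f g z w \<partial>circle_measure)"

end

theory Submission
  imports Defs
begin

text \<open>
  The convolution of \<open>|f|\<close> with \<open>|g|\<close> dominates \<open>|f * g|\<close>, so everything reduces to nonnegative
  scalar functions. Continuity of the norm on small sets gives it a dominated convergence property.
  For bounded \<open>F\<close>, the convolution is approximated in \<open>L\<^sup>1\<close> by sums of rotations of \<open>F\<close> with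
  weights adding up to \<open>\<parallel>G\<parallel>\<^sub>1\<close>, because rotation is continuous in \<open>L\<^sup>1\<close>; rotational symmetry and the
  triangle inequality bound these sums. Truncation and a Fatou property remove the boundedness.
  Membership in the closure of the bounded functions follows by splitting \<open>f\<close> into a bounded
  function and one of small norm.
\<close>

text \<open>The norm \<open>\<alpha>\<close> is given on \<open>Linfty\<close> with a triangle
  inequality for two summands only, so the inequality of Minkowski type for integrals has to be
  built from finite sums. Since \<open>F\<close> is merely measurable, the Riemann sums of the
  convolution need not converge pointwise; L^1 convergence is what averaging over the circle
  provides. The L^1 norm does not control \<open>\<alpha>\<close> in general, but it does on
  uniformly bounded families, which is why bounded \<open>F\<close> is treated separately. The
  extended norm is a supremum over competitors \<open>s\<close>. Estimates are therefore proved for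
  one bounded \<open>s\<close> at a time, and the fixed bound of \<open>s\<close> supplies the
  uniform bound that the truncations of \<open>F\<close> lack.\<close>

section \<open>Normalized arc length and its rotation invariance\<close>

lemma space_circle_measure: "space circle_measure = sphere 0 1"
  by (simp add: circle_measure_def space_restrict_space)

lemma sets_circle_measure [measurable_cong]:
  "sets circle_measure = sets (restrict_space borel (sphere 0 1))"
  by (simp add: circle_measure_def)

lemma measurable_cis_circle:
  "(\<lambda>t. cis (2 * pi * t)) \<in> borel \<rightarrow>\<^sub>M restrict_space borel (sphere 0 1)"
  by (intro measurable_restrict_space2 borel_measurable_continuous_onI continuous_intros) auto

lemma measurable_cis_circle_measure [measurable]:
  "(\<lambda>t. cis (2 * pi * t)) \<in> borel \<rightarrow>\<^sub>M circle_measure"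
  using measurable_cis_circle by (simp add: measurable_cong_sets[OF refl sets_circle_measure])

lemma nn_integral_circle_measure:
  assumes [measurable]: "f \<in> borel_measurable circle_measure"
  shows "(\<integral>\<^sup>+z. f z \<partial>circle_measure)
    = (\<integral>\<^sup>+t. f (cis (2 * pi * t)) * indicator {0..1} t \<partial>lborel)"
proof -
  have "(\<integral>\<^sup>+z. f z \<partial>circle_measure)
      = (\<integral>\<^sup>+t. f (cis (2 * pi * t)) \<partial>uniform_measure lborel {0..1})"
    unfolding circle_measure_def
    using measurable_cis_circle assms
    by (intro nn_integral_distr) (simp_all add: measurable_cong_sets[OF sets_circle_measure refl])
  also have "\<dots> = (\<integral>\<^sup>+t. f (cis (2 * pi * t)) * indicator {0..1} t \<partial>lborel)"
    by (subst nn_integral_uniform_measure) (auto simp: divide_ennreal_def)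
  finally show ?thesis .
qed

lemma emeasure_space_circle_measure: "emeasure circle_measure (space circle_measure) = 1"
  using nn_integral_circle_measure[of "\<lambda>_. 1"] by simp

interpretation circle: finite_measure circle_measure
  by standard (simp add: emeasure_space_circle_measure)

lemma measurable_into_circle_measure:
  "f \<in> M \<rightarrow>\<^sub>M circle_measure
    \<longleftrightarrow> f \<in> borel_measurable M \<and> f \<in> space M \<rightarrow> sphere 0 1"
  by (auto simp: measurable_cong_sets[OF refl sets_circle_measure] measurable_restrict_space2_iff)

lemma measurable_circle_borel: "(\<lambda>z. z) \<in> borel_measurable circle_measure"
  by (simp add: measurable_cong_sets[OF sets_circle_measure refl] measurable_restrict_space1)

lemma measurable_circle_rotation [measurable (raw)]:
  assumes [measurable]: "f \<in> M \<rightarrow>\<^sub>M circle_measure" "g \<in> M \<rightarrow>\<^sub>M circle_measure"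
  shows "(\<lambda>x. cnj (g x) * f x) \<in> M \<rightarrow>\<^sub>M circle_measure"
proof -
  have [measurable]: "f \<in> borel_measurable M" "g \<in> borel_measurable M"
    using assms by (simp_all add: measurable_into_circle_measure)
  have [measurable]: "cnj \<in> borel_measurable borel"
    by (intro borel_measurable_continuous_onI continuous_intros)
  have "(\<lambda>x. cnj (g x) * f x) \<in> borel_measurable M"
    by measurable
  then show ?thesis
    using assms by (auto simp: measurable_into_circle_measure norm_mult Pi_iff)
qed

lemma measurable_mult_circle [measurable]:
  "w \<in> sphere 0 1 \<Longrightarrow> (\<lambda>z. w * z) \<in> circle_measure \<rightarrow>\<^sub>M circle_measure"
  unfolding measurable_into_circle_measure
  by (auto simp: space_circle_measure norm_mult intro!: borel_measurable_times measurable_circle_borel)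

text \<open>Pulled back to the line, \<open>f\<close> becomes 1-periodic and rotation becomes
  translation by \<open>a\<close>. The part of the translated unit interval beyond 1 is moved back
  to the start by periodicity.\<close>

lemma nn_integral_circle_measure_rotate:
  assumes [measurable]: "f \<in> borel_measurable circle_measure" and w: "w \<in> sphere 0 1"
  shows "(\<integral>\<^sup>+z. f (w * z) \<partial>circle_measure) = (\<integral>\<^sup>+z. f z \<partial>circle_measure)"
proof -
  define \<phi> where "\<phi> = (\<lambda>t. f (cis (2 * pi * t)))"
  have [measurable]: "\<phi> \<in> borel_measurable borel"
    unfolding \<phi>_def by measurable
  \<comment> \<open>The fractional part puts the shift in [0,1), so the translated interval crosses
    1 at most once.\<close>
  define a where "a = frac (Arg w / (2 * pi))"
  have a: "0 \<le> a" "a < 1"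
    by (auto simp: a_def frac_lt_1)
  have "2 * pi * a = Arg w - 2 * pi * of_int \<lfloor>Arg w / (2 * pi)\<rfloor>"
    by (simp add: a_def frac_def algebra_simps)
  then have "cis (2 * pi * a) = cis (Arg w) / cis (2 * pi * of_int \<lfloor>Arg w / (2 * pi)\<rfloor>)"
    by (simp only: cis_divide)
  also have "\<dots> = w"
    using w cis_Arg[of w] by (cases "w = 0") (simp_all add: cis_multiple_2pi sgn_div_norm)
  finally have cis_a: "cis (2 * pi * a) = w" .
  have per: "\<phi> (t + 1) = \<phi> t" for t
    by (simp add: \<phi>_def distrib_left flip: cis_mult)
  \<comment> \<open>Half-open intervals tile the line exactly, so \<open>split\<close> can be
    checked pointwise; the closed interval differs from the half-open one by a null set.\<close>
  have ae: "AE t in lborel. (indicator {0..1::real} t :: ennreal) = indicator {0..<1} t"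
    by (rule AE_I[where N = "{1}"]) (auto simp: indicator_def)
  have split: "(\<integral>\<^sup>+t. \<phi> t * indicator {x..<z} t \<partial>lborel)
      = (\<integral>\<^sup>+t. \<phi> t * indicator {x..<y} t \<partial>lborel)
        + (\<integral>\<^sup>+t. \<phi> t * indicator {y..<z} t \<partial>lborel)" if "x \<le> y" "y \<le> z" for x y z
    using that by (subst nn_integral_add[symmetric])
      (auto intro!: nn_integral_cong simp: indicator_def)
  have shift: "(\<integral>\<^sup>+t. \<phi> (t + s) * indicator {x..<y} t \<partial>lborel)
      = (\<integral>\<^sup>+t. \<phi> t * indicator {x + s..<y + s} t \<partial>lborel)" for x y s
    by (subst nn_integral_real_affine[where c = 1 and t = s and f = "\<lambda>t. \<phi> t * indicator {x + s..<y + s} t"])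
      (auto intro!: nn_integral_cong simp: indicator_def add_ac)
  have period: "(\<integral>\<^sup>+t. \<phi> t * indicator {0 + 1..<a + 1} t \<partial>lborel)
      = (\<integral>\<^sup>+t. \<phi> t * indicator {0..<a} t \<partial>lborel)"
    by (subst shift[symmetric]) (simp add: per)
  have "(\<integral>\<^sup>+z. f (w * z) \<partial>circle_measure)
      = (\<integral>\<^sup>+t. \<phi> (t + a) * indicator {0..1} t \<partial>lborel)"
    using w by (subst nn_integral_circle_measure)
      (measurable, auto simp: \<phi>_def cis_a distrib_left mult.commute[of w] simp flip: cis_mult)
  also have "\<dots> = (\<integral>\<^sup>+t. \<phi> (t + a) * indicator {0..<1} t \<partial>lborel)"
    using ae by (intro nn_integral_cong_AE) auto
  also have "\<dots> = (\<integral>\<^sup>+t. \<phi> t * indicator {a..<1 + a} t \<partial>lborel)"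
    by (simp add: shift)
  also have "\<dots> = (\<integral>\<^sup>+t. \<phi> t * indicator {a..<1} t \<partial>lborel)
      + (\<integral>\<^sup>+t. \<phi> t * indicator {0 + 1..<a + 1} t \<partial>lborel)"
    using a by (simp add: split[of a 1 "1 + a"] add_ac)
  also have "\<dots> = (\<integral>\<^sup>+t. \<phi> t * indicator {0..<1} t \<partial>lborel)"
    unfolding period using a by (simp add: split[of 0 a 1] add.commute)
  also have "\<dots> = (\<integral>\<^sup>+t. \<phi> t * indicator {0..1} t \<partial>lborel)"
    using ae by (intro nn_integral_cong_AE) auto
  also have "\<dots> = (\<integral>\<^sup>+z. f z \<partial>circle_measure)"
    by (simp add: \<phi>_def nn_integral_circle_measure)
  finally show ?thesis .
qed

section \<open>Continuity of rotation in L^1\<close>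

text \<open>Approximation in L^1 by a continuous function transfers the question to one where
  uniform continuity answers it. Boundedness of \<open>F\<close> makes the approximation a case of
  dominated convergence.\<close>

lemma L1_continuous_rotation_0:
  fixes F :: "complex \<Rightarrow> real"
  assumes [measurable]: "F \<in> borel_measurable circle_measure"
    and F: "\<And>z. z \<in> sphere 0 1 \<Longrightarrow> \<bar>F z\<bar> \<le> M" and e: "0 < e"
  shows "\<exists>\<delta>>0. \<forall>s. \<bar>s\<bar> < \<delta> \<longrightarrow>
    (\<integral>\<^sup>+z. ennreal \<bar>F (cis (2 * pi * s) * z) - F z\<bar> \<partial>circle_measure) < ennreal e"
proof -
  define \<phi> where "\<phi> = (\<lambda>t. F (cis (2 * pi * t)))"
  have [measurable]: "\<phi> \<in> borel_measurable borel"
    unfolding \<phi>_def by measurable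
  have bound: "\<bar>\<phi> t\<bar> \<le> M" for t
    by (simp add: \<phi>_def F)
  have "\<phi> \<in> borel_measurable lebesgue"
    by (rule measurable_completion) simp
  \<comment> \<open>This notion of measurability supplies continuous functions converging to
    \<open>\<phi>\<close> off a negligible set. They need not be periodic, so the argument stays on
    an interval of the line.\<close>
  then have "\<phi> measurable_on UNIV"
    by (rule lebesgue_measurable_imp_measurable_on_real) simp
  then obtain N g where N: "negligible N" and cont: "\<And>n. continuous_on UNIV (g n)"
    and lim: "\<And>x. x \<notin> N \<Longrightarrow> (\<lambda>n. g n x) \<longlonglongrightarrow> \<phi> x"
    unfolding measurable_on_def by auto
  \<comment> \<open>Clipping to [-M, M] preserves continuity and the limit, and yields an integrable
    majorant on \<open>I\<close>.\<close>
  define h where "h n x = max (- M) (min M (g n x))" for n :: nat and x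
  have cont_h: "continuous_on UNIV (h n)" for n
    unfolding h_def by (intro continuous_intros cont)
  have [measurable]: "h n \<in> borel_measurable borel" for n
    by (rule borel_measurable_continuous_onI[OF cont_h])
  have bound_h: "\<bar>h n t\<bar> \<le> M" for n t
    using bound[of t] by (auto simp: h_def)
  have lim_h: "(\<lambda>n. h n x) \<longlonglongrightarrow> \<phi> x" if "x \<notin> N" for x
  proof -
    have "(\<lambda>n. h n x) \<longlonglongrightarrow> max (- M) (min M (\<phi> x))"
      unfolding h_def by (intro tendsto_intros lim that)
    then show ?thesis
      using bound[of x] by (simp add: abs_le_iff max_absorb2 min_absorb2)
  qed
  \<comment> \<open>\<open>I\<close> contains \<open>t\<close> and \<open>t + s\<close> whenever
    \<open>t\<close> lies in [0,1] and \<open>|s| < 1\<close>.\<close>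
  define I where "I = {-1..2::real}"
  have [measurable]: "I \<in> sets borel"
    by (simp add: I_def)
  have "(\<lambda>n. \<integral>\<^sup>+x. norm (\<phi> x * indicator I x - h n x * indicator I x) \<partial>lborel) \<longlonglongrightarrow> 0"
  proof (rule nn_integral_dominated_convergence_norm)
    show "AE x in lborel. norm (h n x * indicator I x) \<le> M * indicator I x" for n
      using bound_h by (auto simp: indicator_def)
    have "(\<integral>\<^sup>+x. ennreal (M * indicator I x) \<partial>lborel) = ennreal M * emeasure lborel I"
      using bound[of 0] by (subst nn_integral_cmult_indicator[symmetric])
        (auto intro!: nn_integral_cong simp: indicator_def)
    also have "\<dots> < \<infinity>"
      by (simp add: I_def ennreal_mult_less_top)
    finally show "(\<integral>\<^sup>+x. ennreal (M * indicator I x) \<partial>lborel) < \<infinity>" .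
    have "AE x in lborel. x \<notin> N"
      using N by (subst AE_completion_iff[symmetric])
        (simp add: negligible_iff_null_sets AE_not_in)
    then show "AE x in lborel. (\<lambda>n. h n x * indicator I x) \<longlonglongrightarrow> \<phi> x * indicator I x"
      by eventually_elim (auto intro!: tendsto_intros lim_h)
  qed measurable
  moreover have "0 < ennreal (e / 4)"
    using e by simp
  ultimately have "\<forall>\<^sub>F n in sequentially.
      (\<integral>\<^sup>+x. norm (\<phi> x * indicator I x - h n x * indicator I x) \<partial>lborel) < ennreal (e / 4)"
    by (rule order_tendstoD)
  then obtain n where "(\<integral>\<^sup>+x. norm (\<phi> x * indicator I x - h n x * indicator I x) \<partial>lborel) < ennreal (e / 4)"
    by (auto simp: eventually_sequentially)
  moreover define D where "D x = ennreal (\<bar>\<phi> x - h n x\<bar> * indicator I x)" for x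
  have "(\<lambda>x. ennreal (norm (\<phi> x * indicator I x - h n x * indicator I x))) = D"
    by (auto simp: D_def indicator_def)
  ultimately have D: "(\<integral>\<^sup>+x. D x \<partial>lborel) < ennreal (e / 4)"
    by simp
  have [measurable]: "D \<in> borel_measurable borel"
    unfolding D_def by measurable
  have unif: "uniformly_continuous_on I (h n)"
    unfolding I_def
    by (intro compact_uniformly_continuous continuous_on_subset[OF cont_h]) auto
  then obtain d where d: "d > 0"
    and close: "\<And>x y. x \<in> I \<Longrightarrow> y \<in> I \<Longrightarrow> dist y x < d \<Longrightarrow> dist (h n y) (h n x) < e / 4"
    using unif[unfolded uniformly_continuous_on_def, rule_format, of "e / 4"] e by auto
  have "(\<integral>\<^sup>+z. ennreal \<bar>F (cis (2 * pi * s) * z) - F z\<bar> \<partial>circle_measure) < ennreal e"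
    if s: "\<bar>s\<bar> < min d 1" for s
  proof -
    have "(\<integral>\<^sup>+z. ennreal \<bar>F (cis (2 * pi * s) * z) - F z\<bar> \<partial>circle_measure)
        = (\<integral>\<^sup>+t. ennreal \<bar>\<phi> (t + s) - \<phi> t\<bar> * indicator {0..1} t \<partial>lborel)"
      by (subst nn_integral_circle_measure)
        (measurable, auto simp: \<phi>_def distrib_left mult.commute[of "cis (2 * pi * s)"] simp flip: cis_mult)
    \<comment> \<open>Three errors of e / 4 each: replacing \<open>\<phi>\<close> by
      \<open>h n\<close> at \<open>t + s\<close> and at \<open>t\<close>, and moving
      \<open>h n\<close> by \<open>s\<close>. A quarter instead of a third leaves room for the
      strict inequality.\<close>
    also have "\<dots> \<le> (\<integral>\<^sup>+t. D (t + s) + (D t + ennreal (e / 4) * indicator {0..1} t) \<partial>lborel)"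
    proof (rule nn_integral_mono)
      fix t :: real
      show "ennreal \<bar>\<phi> (t + s) - \<phi> t\<bar> * indicator {0..1} t
          \<le> D (t + s) + (D t + ennreal (e / 4) * indicator {0..1} t)"
      proof (cases "t \<in> {0..1}")
        case True
        then have I: "t \<in> I" "t + s \<in> I"
          using s by (auto simp: I_def)
        have "dist (h n (t + s)) (h n t) < e / 4"
          using s by (intro close I) (auto simp: dist_real_def)
        then have "\<bar>\<phi> (t + s) - \<phi> t\<bar> \<le> \<bar>\<phi> (t + s) - h n (t + s)\<bar> + (\<bar>\<phi> t - h n t\<bar> + e / 4)"
          unfolding dist_real_def by linarith
        then show ?thesis
          using True I e by (simp add: D_def flip: ennreal_plus)
      qed simp
    qed
    also have "\<dots> = (\<integral>\<^sup>+t. D (t + s) \<partial>lborel) + ((\<integral>\<^sup>+t. D t \<partial>lborel) + ennreal (e / 4))"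
      by (simp add: nn_integral_add nn_integral_cmult)
    also have "(\<integral>\<^sup>+t. D (t + s) \<partial>lborel) = (\<integral>\<^sup>+t. D t \<partial>lborel)"
      by (subst nn_integral_real_affine[where c = 1 and t = s and f = D]) (auto simp: add.commute)
    also have "(\<integral>\<^sup>+t. D t \<partial>lborel) + ((\<integral>\<^sup>+t. D t \<partial>lborel) + ennreal (e / 4))
        \<le> ennreal (e / 4) + (ennreal (e / 4) + ennreal (e / 4))"
      using D by (intro add_mono) auto
    also have "\<dots> = ennreal (3 / 4 * e)"
      using e by (simp flip: ennreal_plus)
    also have "\<dots> < ennreal e"
      using e by (intro ennreal_lessI) auto
    finally show ?thesis .
  qed
  then show ?thesis
    using d by (intro exI[of _ "min d 1"]) auto
qed

text \<open>Substituting \<open>cis (2 * pi * s') * z\<close> for \<open>z\<close> reduces to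
  comparing one rotation with the identity. Only \<open>s - s'\<close> matters, so a single
  \<open>\<delta>\<close> serves all arcs of a uniform partition of the circle.\<close>

lemma L1_continuous_rotation:
  fixes F :: "complex \<Rightarrow> real"
  assumes [measurable]: "F \<in> borel_measurable circle_measure"
    and F: "\<And>z. z \<in> sphere 0 1 \<Longrightarrow> \<bar>F z\<bar> \<le> M" and e: "0 < e"
  shows "\<exists>\<delta>>0. \<forall>s s'. \<bar>s - s'\<bar> < \<delta> \<longrightarrow>
    (\<integral>\<^sup>+z. ennreal \<bar>F (cnj (cis (2 * pi * s)) * z) - F (cnj (cis (2 * pi * s')) * z)\<bar>
      \<partial>circle_measure) < ennreal e"
proof -
  obtain \<delta> where \<delta>: "\<delta> > 0"
    and less: "\<And>s. \<bar>s\<bar> < \<delta> \<Longrightarrow>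
      (\<integral>\<^sup>+z. ennreal \<bar>F (cis (2 * pi * s) * z) - F z\<bar> \<partial>circle_measure) < ennreal e"
    using L1_continuous_rotation_0[OF assms] by auto
  have "(\<integral>\<^sup>+z. ennreal \<bar>F (cnj (cis (2 * pi * s)) * z) - F (cnj (cis (2 * pi * s')) * z)\<bar>
      \<partial>circle_measure) < ennreal e" if s: "\<bar>s - s'\<bar> < \<delta>" for s s'
  proof -
    have [simp]: "cnj (cis (2 * pi * s)) * (cis (2 * pi * s') * z) = cis (2 * pi * (s' - s)) * z" for z
      by (simp add: right_diff_distrib cis_cnj mult.assoc[symmetric] cis_mult)
    have [simp]: "cnj (cis (2 * pi * s')) * (cis (2 * pi * s') * z) = z" for z
      by (simp add: cis_cnj mult.assoc[symmetric] cis_mult)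
    have "(\<integral>\<^sup>+z. ennreal \<bar>F (cnj (cis (2 * pi * s)) * z) - F (cnj (cis (2 * pi * s')) * z)\<bar>
        \<partial>circle_measure)
      = (\<integral>\<^sup>+z. ennreal \<bar>F (cis (2 * pi * (s' - s)) * z) - F z\<bar> \<partial>circle_measure)"
      by (subst nn_integral_circle_measure_rotate[where w = "cis (2 * pi * s')", symmetric]) auto
    also have "\<dots> < ennreal e"
      using s by (intro less) auto
    finally show ?thesis .
  qed
  then show ?thesis
    using \<delta> by blast
qed

section \<open>Bounded functions and monotonicity of the extended norm\<close>

lemma LinftyI:
  "\<lbrakk>f \<in> borel_measurable circle_measure; AE z in circle_measure. norm (f z) \<le> C\<rbrakk> \<Longrightarrow> f \<in> Linfty"
  by (auto simp: Linfty_def)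

lemma LinftyE:
  assumes "f \<in> Linfty"
  obtains C where "f \<in> borel_measurable circle_measure"
    and "AE z in circle_measure. norm (f z) \<le> C"
  using assms by (auto simp: Linfty_def)

lemma Linfty_cmult:
  assumes "f \<in> Linfty"
  shows "(\<lambda>z. c * f z) \<in> Linfty"
proof -
  obtain C where [measurable]: "f \<in> borel_measurable circle_measure"
    and C: "AE z in circle_measure. norm (f z) \<le> C"
    using assms by (rule LinftyE)
  show ?thesis
    by (rule LinftyI[where C = "norm c * C"])
      (measurable, use C in \<open>eventually_elim, auto simp: norm_mult intro: mult_left_mono\<close>)
qed

lemma Linfty_add:
  assumes "f \<in> Linfty" "g \<in> Linfty"
  shows "(\<lambda>z. f z + g z) \<in> Linfty"
proof -
  obtain C where [measurable]: "f \<in> borel_measurable circle_measure"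
    and C: "AE z in circle_measure. norm (f z) \<le> C"
    using assms(1) by (rule LinftyE)
  obtain D where [measurable]: "g \<in> borel_measurable circle_measure"
    and D: "AE z in circle_measure. norm (g z) \<le> D"
    using assms(2) by (rule LinftyE)
  show ?thesis
    by (rule LinftyI[where C = "C + D"])
      (measurable, use C D in \<open>eventually_elim, auto intro: norm_triangle_le\<close>)
qed

lemma Linfty_simple_function:
  assumes "simple_function circle_measure s"
  shows "s \<in> Linfty"
proof (rule LinftyI)
  show "s \<in> borel_measurable circle_measure"
    using assms by (rule borel_measurable_simple_function)
  have "finite (s ` space circle_measure)"
    using assms by (simp add: simple_function_def)
  then show "AE z in circle_measure. norm (s z) \<le> Max (norm ` s ` space circle_measure)"
    by (intro AE_I2 Max_ge) auto
qed

lemma ext_norm_mono: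
  "AE z in circle_measure. norm (f z) \<le> norm (g z) \<Longrightarrow> ext_norm \<alpha> f \<le> ext_norm \<alpha> g"
  unfolding ext_norm_def by (intro SUP_subset_mono) (auto elim: eventually_elim2)

section \<open>Domination, limits and the Fatou property for the norm\<close>

context continuous_rotationally_symmetric_norm
begin

lemma zero: "\<alpha> (\<lambda>z. 0) = 0"
proof -
  have "(\<lambda>z. 0) \<in> Linfty"
    by (rule LinftyI[where C = 0]) auto
  from scale[OF this, of 0] show ?thesis
    by simp
qed

text \<open>A function dominated by \<open>|g|\<close> is \<open>|g|\<close> times an average of two unimodular functions.\<close>

lemma mono:
  assumes "f \<in> Linfty" "g \<in> Linfty"
    and le: "AE z in circle_measure. norm (f z) \<le> norm (g z)"
  shows "\<alpha> f \<le> \<alpha> g"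
proof -
  obtain C where [measurable]: "f \<in> borel_measurable circle_measure"
    and C: "AE z in circle_measure. norm (f z) \<le> C"
    using assms(1) by (rule LinftyE)
  obtain D where [measurable]: "g \<in> borel_measurable circle_measure"
    and D: "AE z in circle_measure. norm (g z) \<le> D"
    using assms(2) by (rule LinftyE)
  \<comment> \<open>The unimodular factors are the two points of the unit circle with real part
    \<open>r z\<close>. The minimum keeps \<open>r z \<le> 1\<close> on the null set where the
    domination fails; at zeros of \<open>g\<close>, division by zero gives 0.\<close>
  define r where "r z = min 1 (norm (f z) / norm (g z))" for z
  define v where "v \<sigma> z = (complex_of_real (r z) + \<i> * complex_of_real (\<sigma> * sqrt (1 - (r z)\<^sup>2)))
      * complex_of_real (norm (g z))" for \<sigma> :: real and z
  have [measurable]: "r \<in> borel_measurable circle_measure"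
    unfolding r_def by measurable
  have [measurable]: "v \<sigma> \<in> borel_measurable circle_measure" for \<sigma>
    unfolding v_def by measurable
  have r: "0 \<le> r z" "r z \<le> 1" for z
    by (auto simp: r_def)
  have norm_v: "norm (v \<sigma> z) = norm (g z)" if "\<bar>\<sigma>\<bar> = 1" for \<sigma> z
  proof -
    have "\<sigma>\<^sup>2 = 1"
      using that by (auto simp: power2_eq_1_iff)
    moreover have "(r z)\<^sup>2 \<le> 1"
      using r[of z] by (simp add: power_le_one)
    ultimately have "norm (complex_of_real (r z) + \<i> * complex_of_real (\<sigma> * sqrt (1 - (r z)\<^sup>2))) = 1"
      by (simp add: cmod_def power_mult_distrib)
    then show ?thesis
      by (simp add: v_def norm_mult)
  qed
  have v_Linfty: "v \<sigma> \<in> Linfty" if "\<bar>\<sigma>\<bar> = 1" for \<sigma>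
    using D by (intro LinftyI[where C = D]) (auto simp: norm_v[OF that])
  have alpha_v: "\<alpha> (v \<sigma>) = \<alpha> g" if "\<bar>\<sigma>\<bar> = 1" for \<sigma>
    using abs[OF v_Linfty[OF that]] abs[OF assms(2)] by (simp add: norm_v[OF that])
  have half: "(\<lambda>z. (1 / 2) * v \<sigma> z) \<in> Linfty" if "\<bar>\<sigma>\<bar> = 1" for \<sigma>
    by (intro Linfty_cmult v_Linfty that)
  have "\<alpha> f = \<alpha> (\<lambda>z. complex_of_real (norm (f z)))"
    using abs[OF assms(1)] by simp
  also have "\<dots> = \<alpha> (\<lambda>z. (1 / 2) * v 1 z + (1 / 2) * v (-1) z)"
  proof (rule AE_cong)
    show "(\<lambda>z. complex_of_real (norm (f z))) \<in> Linfty"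
      using C by (intro LinftyI[where C = C]) auto
    show "(\<lambda>z. (1 / 2) * v 1 z + (1 / 2) * v (-1) z) \<in> Linfty"
      by (intro Linfty_add half) auto
    show "AE z in circle_measure. complex_of_real (norm (f z)) = (1 / 2) * v 1 z + (1 / 2) * v (-1) z"
      using le
    proof eventually_elim
      case (elim z)
      have "(1 / 2) * v 1 z + (1 / 2) * v (-1) z = complex_of_real (r z * norm (g z))"
        by (simp add: v_def algebra_simps)
      also have "r z * norm (g z) = norm (f z)"
        using elim by (cases "g z = 0") (auto simp: r_def)
      finally show ?case by simp
    qed
  qed
  also have "\<dots> \<le> \<alpha> (\<lambda>z. (1 / 2) * v 1 z) + \<alpha> (\<lambda>z. (1 / 2) * v (-1) z)"
    by (intro triangle half) auto
  also have "\<dots> = \<alpha> g"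
    using scale[OF v_Linfty[of 1], of "1 / 2"] scale[OF v_Linfty[of "-1"], of "1 / 2"]
    by (simp add: alpha_v)
  finally show ?thesis .
qed

text \<open>Markov's inequality confines the values of size at least \<open>\<epsilon> / 2\<close>
  to a set \<open>E\<close> of small measure. Off \<open>E\<close> the cost is
  \<open>\<epsilon> / 2\<close>, as the constant 1 has norm 1; on \<open>E\<close> the uniform bound
  and the smallness of the norm of the indicator give the other half.\<close>

lemma small_if_L1_small:
  assumes "0 < \<epsilon>"
  shows "\<exists>\<delta>>0. \<forall>u \<in> borel_measurable circle_measure.
    (AE z in circle_measure. norm (u z) \<le> M) \<longrightarrow>
    (\<integral>\<^sup>+z. norm (u z) \<partial>circle_measure) < ennreal \<delta> \<longrightarrow> \<alpha> u < \<epsilon>"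
proof -
  \<comment> \<open>\<open>M\<close> is an arbitrary real; \<open>K\<close> dominates it and is
    positive, so it can be divided by.\<close>
  define K where "K = \<bar>M\<bar> + 1"
  have K: "K > 0" "M \<le> K"
    by (auto simp: K_def)
  have "0 < \<epsilon> / (2 * K)"
    using assms K by simp
  from continuous[OF this] obtain d where d: "d > 0"
    and small: "\<And>E. \<lbrakk>E \<in> sets circle_measure; 0 < measure circle_measure E;
      measure circle_measure E < d\<rbrakk> \<Longrightarrow> \<alpha> (indicator E) < \<epsilon> / (2 * K)"
    by metis
  \<comment> \<open>The threshold \<open>d * (\<epsilon> / 2)\<close> is what Markov's inequality at
    level \<open>\<epsilon> / 2\<close> converts into measure below \<open>d\<close>.\<close>
  have "\<alpha> u < \<epsilon>" if [measurable]: "u \<in> borel_measurable circle_measure"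
    and M: "AE z in circle_measure. norm (u z) \<le> M"
    and u: "(\<integral>\<^sup>+z. norm (u z) \<partial>circle_measure) < ennreal (d * (\<epsilon> / 2))" for u
  proof -
    define E where "E = {z \<in> space circle_measure. \<epsilon> / 2 \<le> norm (u z)}"
    have [measurable]: "E \<in> sets circle_measure"
      unfolding E_def by measurable
    have "E = {z \<in> space circle_measure. 1 \<le> ennreal (2 / \<epsilon>) * ennreal (norm (u z))}"
      using assms by (auto simp: E_def field_simps simp flip: ennreal_mult ennreal_1)
    then have "emeasure circle_measure E
        \<le> ennreal (2 / \<epsilon>) * (\<integral>\<^sup>+z. ennreal (norm (u z)) * indicator (space circle_measure) z \<partial>circle_measure)"
      by (simp only:) (rule nn_integral_Markov_inequality; measurable)
    also have "(\<integral>\<^sup>+z. ennreal (norm (u z)) * indicator (space circle_measure) z \<partial>circle_measure)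
        = (\<integral>\<^sup>+z. norm (u z) \<partial>circle_measure)"
      by (rule nn_integral_cong) simp
    also have "ennreal (2 / \<epsilon>) * (\<integral>\<^sup>+z. norm (u z) \<partial>circle_measure)
        < ennreal (2 / \<epsilon>) * ennreal (d * (\<epsilon> / 2))"
      using u assms by (intro ennreal_mult_strict_left_mono) auto
    also have "\<dots> = ennreal d"
      using assms d by (simp flip: ennreal_mult)
    finally have less: "measure circle_measure E < d"
      using d by (simp add: circle.emeasure_eq_measure ennreal_less_iff)
    have ind: "indicator E \<in> Linfty"
      by (rule LinftyI[where C = 1]) (auto simp: indicator_def)
    have "\<alpha> (indicator E) < \<epsilon> / (2 * K)"
    \<comment> \<open>Continuity is formulated for sets of positive measure; for a null set the
      indicator equals 0 almost everywhere.\<close>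
    proof (cases "measure circle_measure E = 0")
      case True
      then have "E \<in> null_sets circle_measure"
        by (auto simp: circle.emeasure_eq_measure)
      from AE_not_in[OF this] have "AE z in circle_measure. indicator E z = (0 :: complex)"
        by eventually_elim simp
      then have "\<alpha> (indicator E) = \<alpha> (\<lambda>z. 0)"
        by (intro AE_cong ind LinftyI[where C = 0]) auto
      then show ?thesis
        using assms K by (simp add: zero)
    next
      case False
      then have "0 < measure circle_measure E"
        by (simp add: zero_less_measure_iff circle.emeasure_eq_measure)
      then show ?thesis
        by (intro small less) auto
    qed
    have const: "(\<lambda>z. 1) \<in> Linfty"
      by (rule LinftyI[where C = 1]) auto
    have "\<alpha> u \<le> \<alpha> (\<lambda>z. complex_of_real (\<epsilon> / 2) * 1 + complex_of_real K * indicator E z)"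
    proof (rule mono)
      show "u \<in> Linfty"
        using M by (intro LinftyI) auto
      show "(\<lambda>z. complex_of_real (\<epsilon> / 2) * 1 + complex_of_real K * indicator E z) \<in> Linfty"
        by (intro Linfty_add Linfty_cmult ind const)
      show "AE z in circle_measure.
          norm (u z) \<le> norm (complex_of_real (\<epsilon> / 2) * 1 + complex_of_real K * indicator E z)"
        using M AE_space
      proof eventually_elim
        case (elim z)
        have "complex_of_real (\<epsilon> / 2) * 1 + complex_of_real K * indicator E z
            = complex_of_real (\<epsilon> / 2 + K * indicator E z)"
          by (simp add: indicator_def)
        moreover have "norm (u z) \<le> \<bar>\<epsilon> / 2 + K * indicator E z\<bar>"
          using elim assms K by (cases "z \<in> E") (auto simp: E_def)
        ultimately show ?case
          by (simp only: norm_of_real)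
      qed
    qed
    also have "\<dots> \<le> \<alpha> (\<lambda>z. complex_of_real (\<epsilon> / 2) * 1) + \<alpha> (\<lambda>z. complex_of_real K * indicator E z)"
      by (intro triangle Linfty_cmult ind const)
    also have "\<dots> = \<epsilon> / 2 + K * \<alpha> (indicator E)"
      using assms K scale[OF const, of "complex_of_real (\<epsilon> / 2)"]
        scale[OF ind, of "complex_of_real K"] by (simp add: one)
    also have "\<dots> < \<epsilon> / 2 + K * (\<epsilon> / (2 * K))"
      using K \<open>\<alpha> (indicator E) < \<epsilon> / (2 * K)\<close> by (intro add_strict_left_mono mult_strict_left_mono)
    also have "\<dots> = \<epsilon>"
      using K by simp
    finally show ?thesis .
  qed
  then show ?thesis
    using assms d by (intro exI[of _ "d * (\<epsilon> / 2)"]) auto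
qed

text \<open>The common bound \<open>M\<close> bounds the differences by \<open>2 * M\<close>, so
  \<open>small_if_L1_small\<close> turns L^1 convergence into convergence in
  \<open>\<alpha>\<close>.\<close>

lemma le_of_L1_limit:
  assumes [measurable]: "\<And>k. u k \<in> borel_measurable circle_measure" "v \<in> borel_measurable circle_measure"
    and u: "\<And>k::nat. AE z in circle_measure. norm (u k z) \<le> M"
    and v: "AE z in circle_measure. norm (v z) \<le> M"
    and lim: "(\<lambda>k. \<integral>\<^sup>+z. norm (v z - u k z) \<partial>circle_measure) \<longlonglongrightarrow> 0"
    and le: "\<And>k. \<alpha> (u k) \<le> C"
  shows "\<alpha> v \<le> C"
proof (rule field_le_epsilon)
  fix \<epsilon> :: real assume "0 < \<epsilon>"
  from small_if_L1_small[OF this, of "2 * M"] obtain \<delta> where "\<delta> > 0"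
    and small: "\<And>w. \<lbrakk>w \<in> borel_measurable circle_measure; AE z in circle_measure. norm (w z) \<le> 2 * M;
      (\<integral>\<^sup>+z. norm (w z) \<partial>circle_measure) < ennreal \<delta>\<rbrakk> \<Longrightarrow> \<alpha> w < \<epsilon>"
    by metis
  have "\<forall>\<^sub>F k in sequentially. (\<integral>\<^sup>+z. norm (v z - u k z) \<partial>circle_measure) < ennreal \<delta>"
    using \<open>\<delta> > 0\<close> by (intro order_tendstoD(2)[OF lim]) simp
  then obtain k where k: "(\<integral>\<^sup>+z. norm (v z - u k z) \<partial>circle_measure) < ennreal \<delta>"
    by (auto simp: eventually_sequentially)
  have bound: "AE z in circle_measure. norm (v z - u k z) \<le> 2 * M"
    using v u[of k] by eventually_elim (auto intro: norm_triangle_le_diff)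
  have "\<alpha> v = \<alpha> (\<lambda>z. (v z - u k z) + u k z)"
    by simp
  also have "\<dots> \<le> \<alpha> (\<lambda>z. v z - u k z) + \<alpha> (u k)"
    by (intro triangle LinftyI[OF _ bound] LinftyI[OF _ u]) measurable
  also have "\<dots> \<le> \<epsilon> + C"
    using le[of k] small[OF _ bound k] by simp
  finally show "\<alpha> v \<le> C + \<epsilon>"
    by simp
qed

text \<open>On a finite measure space the constant \<open>M\<close> is an integrable majorant, so
  dominated convergence leads to \<open>le_of_L1_limit\<close>.\<close>

lemma le_of_AE_limit:
  assumes [measurable]: "\<And>k. u k \<in> borel_measurable circle_measure" "v \<in> borel_measurable circle_measure"
    and u: "\<And>k::nat. AE z in circle_measure. norm (u k z) \<le> M"
    and lim: "AE z in circle_measure. (\<lambda>k. u k z) \<longlonglongrightarrow> v z"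
    and le: "\<And>k. \<alpha> (u k) \<le> C"
  shows "\<alpha> v \<le> C"
proof (rule le_of_L1_limit[OF _ _ u _ _ le])
  have "AE z in circle_measure. \<forall>k. norm (u k z) \<le> M"
    using u by (simp add: AE_all_countable)
  then show "AE z in circle_measure. norm (v z) \<le> M"
    using lim by eventually_elim (blast intro: Lim_norm_ubound[OF sequentially_bot] always_eventually)
  show "(\<lambda>k. \<integral>\<^sup>+z. norm (v z - u k z) \<partial>circle_measure) \<longlonglongrightarrow> 0"
    by (rule nn_integral_dominated_convergence_norm[where w = "\<lambda>_. M"])
      (use u lim in \<open>auto simp: emeasure_space_circle_measure ennreal_mult_less_top\<close>)
qed auto

text \<open>Simple functions increasing to \<open>|u|\<close> are competitors in the supremum, and
  bounds on \<open>\<alpha>\<close> pass to their limit by \<open>le_of_AE_limit\<close>. Hence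
  competitors may be arbitrary bounded functions.\<close>

lemma le_ext_norm:
  assumes "u \<in> Linfty" and le: "AE z in circle_measure. norm (u z) \<le> norm (f z)"
  shows "ennreal (\<alpha> u) \<le> ext_norm \<alpha> f"
proof (cases "ext_norm \<alpha> f")
  case (real C)
  obtain M where [measurable]: "u \<in> borel_measurable circle_measure"
    and M: "AE z in circle_measure. norm (u z) \<le> M"
    using assms(1) by (rule LinftyE)
  obtain s where "incseq s" and simple: "\<And>i. simple_function circle_measure (s i)"
    and bdd: "\<And>x. bdd_above (range (\<lambda>i. s i x))" and s_nonneg: "\<And>i x. (0::real) \<le> s i x"
    and s: "(\<lambda>z. norm (u z)) = (SUP i. s i)"
    using borel_measurable_implies_simple_function_sequence_real[of "\<lambda>z. norm (u z)" circle_measure]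
    by auto
  have norm_u: "norm (u z) = (SUP i. s i z)" for z
    using fun_cong[OF s, of z] by (simp add: image_comp)
  have s_le: "s i z \<le> norm (u z)" for i z
    unfolding norm_u by (intro cSUP_upper bdd) simp
  have lim: "(\<lambda>i. s i z) \<longlonglongrightarrow> norm (u z)" for z
    unfolding norm_u using \<open>incseq s\<close>
    by (intro LIMSEQ_incseq_SUP bdd) (auto simp: incseq_def le_fun_def)
  have simple': "simple_function circle_measure (\<lambda>z. complex_of_real (s i z))" for i
    by (intro simple_function_compose1[OF simple])
  have alpha_s: "\<alpha> (\<lambda>z. complex_of_real (s i z)) \<le> C" for i
  proof -
    have "AE z in circle_measure. norm (complex_of_real (s i z)) \<le> norm (f z)"
      using le s_le[of i] s_nonneg[of i] by (auto elim!: eventually_mono intro: order_trans)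
    then have "ennreal (\<alpha> (\<lambda>z. complex_of_real (s i z))) \<le> ennreal C"
      unfolding real(2)[symmetric] ext_norm_def by (intro SUP_upper) (simp add: simple')
    then show ?thesis
      using real by simp
  qed
  have "\<alpha> (\<lambda>z. complex_of_real (norm (u z))) \<le> C"
  proof (rule le_of_AE_limit[OF _ _ _ _ alpha_s])
    show "(\<lambda>z. complex_of_real (s i z)) \<in> borel_measurable circle_measure" for i
      by (rule borel_measurable_simple_function[OF simple'])
    show "AE z in circle_measure. norm (complex_of_real (s i z)) \<le> M" for i
      using M s_le[of i] s_nonneg[of i] by (auto elim!: eventually_mono intro: order_trans)
    show "AE z in circle_measure. (\<lambda>i. complex_of_real (s i z)) \<longlonglongrightarrow> complex_of_real (norm (u z))"
      by (intro AE_I2 tendsto_of_real lim)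
  qed measurable
  then show ?thesis
    using real abs[OF assms(1)] by (simp add: ennreal_leI)
qed simp

text \<open>Simple functions are bounded. Together with \<open>le_ext_norm\<close> this lets all of
  \<open>Linfty\<close> serve as competitors, in particular truncations of measurable functions,
  which need not be simple.\<close>

lemma ext_norm_le:
  assumes "\<And>s. \<lbrakk>s \<in> Linfty; AE z in circle_measure. norm (s z) \<le> norm (f z)\<rbrakk> \<Longrightarrow> ennreal (\<alpha> s) \<le> C"
  shows "ext_norm \<alpha> f \<le> C"
  unfolding ext_norm_def by (intro SUP_least) (auto intro: assms Linfty_simple_function)

lemma ext_norm_cmult_le:
  assumes "0 < c"
  shows "ext_norm \<alpha> (\<lambda>z. complex_of_real c * f z) \<le> ennreal c * ext_norm \<alpha> f"
proof (rule ext_norm_le)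
  fix s assume s: "s \<in> Linfty" "AE z in circle_measure. norm (s z) \<le> norm (complex_of_real c * f z)"
  define t where "t z = complex_of_real (1 / c) * s z" for z
  have t: "t \<in> Linfty"
    unfolding t_def by (intro Linfty_cmult s)
  have "AE z in circle_measure. norm (t z) \<le> norm (f z)"
    using s(2) by eventually_elim (use assms in \<open>auto simp: t_def norm_mult norm_divide field_simps\<close>)
  then have "ennreal (\<alpha> t) \<le> ext_norm \<alpha> f"
    by (rule le_ext_norm[OF t])
  moreover have "\<alpha> s = c * \<alpha> t"
    using scale[OF t, of "complex_of_real c"] assms by (simp add: t_def)
  ultimately show "ennreal (\<alpha> s) \<le> ennreal c * ext_norm \<alpha> f"
    using assms nonneg[OF t] by (simp add: ennreal_mult mult_left_mono)
qed

text \<open>The bounds \<open>M k\<close> may grow and the supremum may be infinite, so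
  \<open>le_of_AE_limit\<close> cannot be applied to \<open>h\<close>. Cutting \<open>h k\<close> at
  \<open>|s|\<close> gives functions that share the bound of \<open>s\<close>, converge to
  \<open>|s|\<close>, and have norm at most that of \<open>h k\<close> by
  \<open>mono\<close>.\<close>

lemma Fatou:
  assumes [measurable]: "\<And>k. h k \<in> borel_measurable circle_measure"
    and h_nonneg: "\<And>k z. z \<in> sphere 0 1 \<Longrightarrow> 0 \<le> h k z"
    and h_bound: "\<And>k z. z \<in> sphere 0 1 \<Longrightarrow> h k z \<le> M k"
    and inc: "\<And>z. z \<in> sphere 0 1 \<Longrightarrow> incseq (\<lambda>k. h k z)"
    and le: "\<And>k. ennreal (\<alpha> (\<lambda>z. complex_of_real (h k z))) \<le> C"
    and s: "s \<in> Linfty" "AE z in circle_measure. ennreal (norm (s z)) \<le> (SUP k. ennreal (h k z))"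
  shows "ennreal (\<alpha> s) \<le> C"
proof (cases C)
  case (real c)
  obtain B where [measurable]: "s \<in> borel_measurable circle_measure"
    and B: "AE z in circle_measure. norm (s z) \<le> B"
    using s(1) by (rule LinftyE)
  define u where "u k z = min (norm (s z)) (h k z)" for k z
  have [measurable]: "u k \<in> borel_measurable circle_measure" for k
    unfolding u_def by measurable
  have u_nonneg: "0 \<le> u k z" if "z \<in> sphere 0 1" for k z
    using h_nonneg[OF that] by (simp add: u_def)
  have u_bound: "AE z in circle_measure. norm (complex_of_real (u k z)) \<le> B" for k
    using B AE_space
  proof eventually_elim
    case (elim z)
    then show ?case
      using u_nonneg[of z k] by (simp add: space_circle_measure) (simp add: u_def)
  qed
  have "\<alpha> (\<lambda>z. complex_of_real (norm (s z))) \<le> c"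
  proof (rule le_of_AE_limit[OF _ _ u_bound])
    show "AE z in circle_measure. (\<lambda>k. complex_of_real (u k z)) \<longlonglongrightarrow> complex_of_real (norm (s z))"
      using s(2) AE_space
    proof eventually_elim
      case (elim z)
      then have z: "z \<in> sphere 0 1"
        by (simp add: space_circle_measure)
      \<comment> \<open>The limit is taken in \<open>ennreal\<close> because the supremum may be
        infinite; the minimum with the finite \<open>norm (s z)\<close> leads back to the
        reals.\<close>
      have "incseq (\<lambda>k. ennreal (h k z))"
        using inc[OF z] by (auto simp: incseq_def ennreal_leI)
      then have "(\<lambda>k. min (ennreal (norm (s z))) (ennreal (h k z)))
          \<longlonglongrightarrow> min (ennreal (norm (s z))) (SUP k. ennreal (h k z))"
        by (intro tendsto_min tendsto_const LIMSEQ_SUP)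
      also have "min (ennreal (norm (s z))) (SUP k. ennreal (h k z)) = ennreal (norm (s z))"
        using elim by (simp add: min_absorb1)
      also have "(\<lambda>k. min (ennreal (norm (s z))) (ennreal (h k z))) = (\<lambda>k. ennreal (u k z))"
        using h_nonneg[OF z] by (auto simp: u_def min_def ennreal_le_iff)
      finally have "(\<lambda>k. u k z) \<longlonglongrightarrow> norm (s z)"
        using u_nonneg[OF z] by (subst (asm) tendsto_ennreal_iff) auto
      then show ?case
        by (rule tendsto_of_real)
    qed
    show "\<alpha> (\<lambda>z. complex_of_real (u k z)) \<le> c" for k
    proof -
      have "\<alpha> (\<lambda>z. complex_of_real (u k z)) \<le> \<alpha> (\<lambda>z. complex_of_real (h k z))"
      proof (rule mono)
        show "(\<lambda>z. complex_of_real (u k z)) \<in> Linfty"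
          by (rule LinftyI[OF _ u_bound]) measurable
        show "(\<lambda>z. complex_of_real (h k z)) \<in> Linfty"
          using h_nonneg h_bound
          by (intro LinftyI[where C = "M k"] AE_I2) (auto simp: space_circle_measure)
        show "AE z in circle_measure. norm (complex_of_real (u k z)) \<le> norm (complex_of_real (h k z))"
          using h_nonneg[of _ k] by (intro AE_I2) (auto simp: u_def space_circle_measure)
      qed
      also have "\<dots> \<le> c"
        using le[of k] real by simp
      finally show ?thesis .
    qed
  qed measurable
  then show ?thesis
    using real abs[OF s(1)] by (simp add: ennreal_leI)
qed simp

end

section \<open>Measurability and pointwise bounds for vector-valued convolutions\<close>

lemma bounded_linear_scaleC_ii: "bounded_linear (\<lambda>x::'x::complex_banach. \<i> *\<^sub>C x)"
proof (rule bounded_linear_intro[where K = 1])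
  show "\<i> *\<^sub>C (x + y) = \<i> *\<^sub>C x + \<i> *\<^sub>C (y::'x)" for x y
    by (rule scaleC_add_right)
  show "\<i> *\<^sub>C (r *\<^sub>R x) = r *\<^sub>R (\<i> *\<^sub>C (x::'x))" for r x
    by (simp add: scaleC_scaleC mult.commute flip: scaleC_of_real)
  show "norm (\<i> *\<^sub>C (x::'x)) \<le> norm x * 1" for x
    by (simp add: norm_scaleC)
qed

text \<open>Splitting \<open>c\<close> into real and imaginary parts leaves only real scalar
  multiplication and multiplication by \<open>\<i>\<close>, a real-linear isometry and hence
  continuous.\<close>

lemma borel_measurable_scaleC [measurable (raw)]:
  fixes f :: "'a \<Rightarrow> 'x::{complex_banach, second_countable_topology}"
  assumes [measurable]: "c \<in> borel_measurable M" "f \<in> borel_measurable M"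
  shows "(\<lambda>x. c x *\<^sub>C f x) \<in> borel_measurable M"
proof -
  have [measurable]: "(\<lambda>x::'x. \<i> *\<^sub>C x) \<in> borel_measurable borel"
    by (intro borel_measurable_continuous_onI linear_continuous_on bounded_linear_scaleC_ii)
  have "c x *\<^sub>C f x = Re (c x) *\<^sub>R f x + Im (c x) *\<^sub>R (\<i> *\<^sub>C f x)" for x
  proof -
    have "c x *\<^sub>C f x
        = (complex_of_real (Re (c x)) + complex_of_real (Im (c x)) * \<i>) *\<^sub>C f x"
      by (metis complex_eq mult.commute)
    then show ?thesis
      by (simp only: scaleC_add_left scaleC_scaleC[symmetric] scaleC_of_real)
  qed
  then show ?thesis
    by simp
qed

lemma norm_convolution_integrand:
  "norm (convolution_integrand f g z w) = norm (f (cnj w * z)) * norm (g w)"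
  by (simp add: convolution_integrand_def norm_scaleC mult.commute)

lemma measurable_convolution_integrand [measurable (raw)]:
  fixes f :: "complex \<Rightarrow> 'x::{complex_banach, second_countable_topology}"
  assumes [measurable]: "f \<in> borel_measurable circle_measure" "g \<in> borel_measurable circle_measure"
    "a \<in> M \<rightarrow>\<^sub>M circle_measure" "b \<in> M \<rightarrow>\<^sub>M circle_measure"
  shows "(\<lambda>x. convolution_integrand f g (a x) (b x)) \<in> borel_measurable M"
  unfolding convolution_integrand_def by measurable

lemma measurable_convolution:
  fixes f :: "complex \<Rightarrow> 'x::{complex_banach, second_countable_topology}"
  assumes [measurable]: "f \<in> borel_measurable circle_measure" "g \<in> borel_measurable circle_measure"
  shows "convolution f g \<in> borel_measurable circle_measure"
  unfolding convolution_def by measurable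

text \<open>A non-integrable function has Bochner integral 0 by convention. The convolution can thus
  be estimated at every point, before it is known where it exists.\<close>

lemma norm_integral_le_nn_integral:
  fixes f :: "'a \<Rightarrow> 'b::{banach, second_countable_topology}"
  shows "ennreal (norm (integral\<^sup>L M f)) \<le> (\<integral>\<^sup>+x. norm (f x) \<partial>M)"
  by (cases "integrable M f") (auto intro: integral_norm_bound_ennreal simp: not_integrable_integral_eq)

section \<open>Scalar convolutions as L^1 limits of weighted rotations\<close>

lemma bounded_convolution_kernel:
  fixes F G :: "complex \<Rightarrow> real"
  assumes [measurable]: "F \<in> borel_measurable circle_measure"
    and F: "\<And>z. z \<in> sphere 0 1 \<Longrightarrow> 0 \<le> F z \<and> F z \<le> M"
    and G: "integrable circle_measure G" "\<And>w. 0 \<le> G w"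
    and z: "z \<in> sphere 0 1"
  shows "integrable circle_measure (\<lambda>w. F (cnj w * z) * G w)"
    and "0 \<le> (\<integral>w. F (cnj w * z) * G w \<partial>circle_measure)"
    and "(\<integral>w. F (cnj w * z) * G w \<partial>circle_measure) \<le> M * (\<integral>w. G w \<partial>circle_measure)"
proof -
  have [measurable]: "G \<in> borel_measurable circle_measure"
    using G by auto
  have [measurable]: "z \<in> space circle_measure"
    using z by (simp add: space_circle_measure)
  have F': "0 \<le> F (cnj w * z) \<and> F (cnj w * z) \<le> M" if "w \<in> space circle_measure" for w
    using that z by (intro F) (auto simp: space_circle_measure norm_mult)
  show int: "integrable circle_measure (\<lambda>w. F (cnj w * z) * G w)"
  proof (rule Bochner_Integration.integrable_bound)
    show "integrable circle_measure (\<lambda>w. M * G w)"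
      using G by simp
    show "AE w in circle_measure. norm (F (cnj w * z) * G w) \<le> norm (M * G w)"
      using F' G(2) by (intro AE_I2) (force simp: abs_mult intro!: mult_right_mono)
  qed measurable
  show "0 \<le> (\<integral>w. F (cnj w * z) * G w \<partial>circle_measure)"
    using F' G(2) by (intro Bochner_Integration.integral_nonneg_AE AE_I2) simp
  have "(\<integral>w. F (cnj w * z) * G w \<partial>circle_measure) \<le> (\<integral>w. M * G w \<partial>circle_measure)"
    using F' G by (intro integral_mono int) (auto intro: mult_right_mono)
  then show "(\<integral>w. F (cnj w * z) * G w \<partial>circle_measure) \<le> M * (\<integral>w. G w \<partial>circle_measure)"
    by simp
qed

text \<open>The rotations of \<open>F\<close> by the angles \<open>k / N\<close>, weighted by the integrals of \<open>G\<close> over the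
  arcs starting there, approximate the convolution; the weights add up to the integral of \<open>G\<close>.\<close>

lemma convolution_Riemann_sum:
  fixes F G :: "complex \<Rightarrow> real"
  assumes [measurable]: "F \<in> borel_measurable circle_measure"
    and F: "\<And>z. z \<in> sphere 0 1 \<Longrightarrow> 0 \<le> F z \<and> F z \<le> M"
    and G: "integrable circle_measure G" "\<And>w. 0 \<le> G w"
    and e: "0 < e"
  shows "\<exists>(N::nat) (c :: nat \<Rightarrow> real). (\<forall>k. 0 \<le> c k) \<and> (\<Sum>k\<le>N. c k) = (\<integral>w. G w \<partial>circle_measure) \<and>
    (\<integral>\<^sup>+z. ennreal \<bar>(\<integral>w. F (cnj w * z) * G w \<partial>circle_measure)
        - (\<Sum>k\<le>N. c k * F (cnj (cis (2 * pi * (k / N))) * z))\<bar> \<partial>circle_measure)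
      \<le> ennreal e * ennreal (\<integral>w. G w \<partial>circle_measure)"
proof -
  \<comment> \<open>Passing to the angle turns arcs into intervals, which the floor function can
    number.\<close>
  define U where "U = uniform_measure lborel {0..1::real}"
  have sets_U [measurable_cong]: "sets U = sets borel"
    by (simp add: U_def)
  interpret U: finite_measure U
  proof
    show "emeasure U (space U) \<noteq> \<infinity>"
      by (simp add: U_def)
  qed
  interpret UC: pair_sigma_finite circle_measure U ..
  have AE_U: "AE t in U. t \<in> {0..1}"
    unfolding U_def by (rule AE_uniform_measureI) auto
  define \<gamma> where "\<gamma> = (\<lambda>t. G (cis (2 * pi * t)))"
  have [measurable]: "G \<in> borel_measurable circle_measure"
    using G by auto
  have [measurable]: "\<gamma> \<in> borel_measurable borel"
    unfolding \<gamma>_def by measurable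
  have distr: "circle_measure = distr U circle_measure (\<lambda>t. cis (2 * pi * t))"
    unfolding U_def by (subst circle_measure_def) (intro distr_cong; simp add: sets_circle_measure)
  have cis_U [measurable]: "(\<lambda>t. cis (2 * pi * t)) \<in> U \<rightarrow>\<^sub>M circle_measure"
    by measurable
  have int_\<gamma>: "integrable U \<gamma>"
    unfolding \<gamma>_def using G by (subst (asm) distr) (simp add: integrable_distr_eq)
  have \<gamma>_nonneg: "0 \<le> \<gamma> t" for t
    by (simp add: \<gamma>_def G)
  have integral_\<gamma>: "(\<integral>t. \<gamma> t \<partial>U) = (\<integral>w. G w \<partial>circle_measure)"
    using integral_distr[OF cis_U, of G] unfolding \<gamma>_def distr[symmetric] by simp
  have F_abs: "\<bar>F z\<bar> \<le> M" if "z \<in> sphere 0 1" for z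
    using F[OF that] by auto
  obtain \<delta> where "\<delta> > 0" and close: "\<And>s s'. \<bar>s - s'\<bar> < \<delta> \<Longrightarrow>
      (\<integral>\<^sup>+z. ennreal \<bar>F (cnj (cis (2 * pi * s)) * z) - F (cnj (cis (2 * pi * s')) * z)\<bar>
        \<partial>circle_measure) < ennreal e"
    using L1_continuous_rotation[OF assms(1) F_abs e] by blast
  obtain N :: nat where "N > 0" and N: "1 / N < \<delta>"
    using nat_approx_posE[OF \<open>\<delta> > 0\<close>] by (metis zero_less_Suc)
  \<comment> \<open>The index of the arc containing the angle \<open>t\<close>. The minimum gives
    \<open>\<kappa> t \<le> N\<close> for every real \<open>t\<close>, so \<open>split\<close> holds
    without exception; within [0,1] the index \<open>N\<close> occurs only at
    \<open>t = 1\<close>.\<close>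
  define \<kappa> where "\<kappa> t = min N (nat \<lfloor>N * t\<rfloor>)" for t :: real
  have [measurable]: "\<kappa> \<in> borel \<rightarrow>\<^sub>M count_space UNIV"
    unfolding \<kappa>_def by measurable
  have \<kappa>_le: "\<kappa> t \<le> N" for t
    by (simp add: \<kappa>_def)
  have \<kappa>_close: "\<bar>t - \<kappa> t / N\<bar> < \<delta>" if "t \<in> {0..1}" for t
  proof -
    have "real N * t \<le> real N"
      using that by (intro mult_left_le) auto
    from floor_mono[OF this] have "\<lfloor>N * t\<rfloor> \<le> int N"
      by simp
    then have "real (\<kappa> t) = of_int \<lfloor>N * t\<rfloor>"
      using that by (simp add: \<kappa>_def min_absorb2 nat_le_iff)
    then have "\<bar>N * t - \<kappa> t\<bar> < 1"
      by linarith
    then have "\<bar>t - \<kappa> t / N\<bar> < 1 / N"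
      using \<open>N > 0\<close> by (auto simp: abs_less_iff field_simps)
    then show ?thesis
      using N by linarith
  qed
  define c where "c k = (\<integral>t. indicator {t. \<kappa> t = k} t * \<gamma> t \<partial>U)" for k
  have int_ind: "integrable U (\<lambda>t. indicator {t. \<kappa> t = k} t * \<gamma> t)" for k
    by (rule Bochner_Integration.integrable_bound[OF int_\<gamma>]) (auto simp: indicator_def)
  have split: "(\<Sum>k\<le>N. a k * (indicator {t. \<kappa> t = k} t * \<gamma> t)) = a (\<kappa> t) * \<gamma> t" for a t
  proof -
    have "(\<Sum>k\<le>N. a k * (indicator {t. \<kappa> t = k} t * \<gamma> t))
        = (\<Sum>k\<le>N. if k = \<kappa> t then a k * \<gamma> t else 0)"
      by (intro sum.cong) (auto simp: indicator_def)
    also have "\<dots> = a (\<kappa> t) * \<gamma> t"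
      using \<kappa>_le[of t] by (simp add: sum.delta)
    finally show ?thesis .
  qed
  \<comment> \<open>For the constant \<open>a = 1\<close> this computes the total weight; for the
    rotated values of \<open>F\<close> it turns the Riemann sum into the integral of a step function
    against \<open>\<gamma>\<close>.\<close>
  have c_sum: "(\<Sum>k\<le>N. c k * a k) = (\<integral>t. a (\<kappa> t) * \<gamma> t \<partial>U)"
    and int_\<kappa>: "integrable U (\<lambda>t. a (\<kappa> t) * \<gamma> t)" for a :: "nat \<Rightarrow> real"
  proof -
    have "(\<Sum>k\<le>N. c k * a k) = (\<Sum>k\<le>N. \<integral>t. a k * (indicator {t. \<kappa> t = k} t * \<gamma> t) \<partial>U)"
      by (simp add: c_def mult.commute)
    also have "\<dots> = (\<integral>t. (\<Sum>k\<le>N. a k * (indicator {t. \<kappa> t = k} t * \<gamma> t)) \<partial>U)"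
      by (intro Bochner_Integration.integral_sum[symmetric] integrable_mult_right int_ind)
    finally show "(\<Sum>k\<le>N. c k * a k) = (\<integral>t. a (\<kappa> t) * \<gamma> t \<partial>U)"
      by (simp only: split)
    have "integrable U (\<lambda>t. \<Sum>k\<le>N. a k * (indicator {t. \<kappa> t = k} t * \<gamma> t))"
      by (intro Bochner_Integration.integrable_sum integrable_mult_right int_ind)
    then show "integrable U (\<lambda>t. a (\<kappa> t) * \<gamma> t)"
      by (simp only: split)
  qed
  have c_nonneg: "0 \<le> c k" for k
    unfolding c_def by (intro Bochner_Integration.integral_nonneg) (simp add: \<gamma>_nonneg)
  have sum_c: "(\<Sum>k\<le>N. c k) = (\<integral>w. G w \<partial>circle_measure)"
    using c_sum[of "\<lambda>_. 1"] by (simp add: integral_\<gamma>)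
  define D where "D z t = \<bar>F (cnj (cis (2 * pi * t)) * z) - F (cnj (cis (2 * pi * (\<kappa> t / N))) * z)\<bar>"
    for z t
  have [measurable]: "(\<lambda>t. cis (2 * pi * (real (\<kappa> t) / real N))) \<in> U \<rightarrow>\<^sub>M circle_measure"
    by (rule measurable_compose[OF _ measurable_cis_circle_measure]) measurable
  have [measurable]: "(\<lambda>(z, t). D z t) \<in> borel_measurable (circle_measure \<Otimes>\<^sub>M U)"
    unfolding D_def by measurable
  have "(\<integral>\<^sup>+z. ennreal \<bar>(\<integral>w. F (cnj w * z) * G w \<partial>circle_measure)
        - (\<Sum>k\<le>N. c k * F (cnj (cis (2 * pi * (k / N))) * z))\<bar> \<partial>circle_measure)
      \<le> (\<integral>\<^sup>+z. \<integral>\<^sup>+t. ennreal (D z t * \<gamma> t) \<partial>U \<partial>circle_measure)"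
  proof (rule nn_integral_mono)
    fix z assume "z \<in> space circle_measure"
    note this [measurable]
    then have z: "z \<in> sphere 0 1"
      by (simp add: space_circle_measure)
    have meas: "(\<lambda>w. F (cnj w * z) * G w) \<in> borel_measurable circle_measure"
      by measurable
    have int: "integrable U (\<lambda>t. F (cnj (cis (2 * pi * t)) * z) * \<gamma> t)"
      using bounded_convolution_kernel(1)[of F M, OF _ F G z] integrable_distr_eq[OF cis_U meas]
      unfolding \<gamma>_def distr[symmetric] by (simp add: assms)
    have "(\<integral>w. F (cnj w * z) * G w \<partial>circle_measure)
        = (\<integral>t. F (cnj (cis (2 * pi * t)) * z) * \<gamma> t \<partial>U)"
      using integral_distr[OF cis_U meas] unfolding \<gamma>_def distr[symmetric] .
    then have "(\<integral>w. F (cnj w * z) * G w \<partial>circle_measure)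
        - (\<Sum>k\<le>N. c k * F (cnj (cis (2 * pi * (k / N))) * z))
      = (\<integral>t. F (cnj (cis (2 * pi * t)) * z) * \<gamma> t
          - F (cnj (cis (2 * pi * (\<kappa> t / N))) * z) * \<gamma> t \<partial>U)"
      by (subst c_sum, subst Bochner_Integration.integral_diff[OF int]) (auto intro: int_\<kappa>)
    then have "ennreal \<bar>(\<integral>w. F (cnj w * z) * G w \<partial>circle_measure)
        - (\<Sum>k\<le>N. c k * F (cnj (cis (2 * pi * (k / N))) * z))\<bar>
      \<le> (\<integral>\<^sup>+t. norm (F (cnj (cis (2 * pi * t)) * z) * \<gamma> t
          - F (cnj (cis (2 * pi * (\<kappa> t / N))) * z) * \<gamma> t) \<partial>U)"
      by (simp only: real_norm_def[symmetric] norm_integral_le_nn_integral)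
    also have "\<dots> = (\<integral>\<^sup>+t. ennreal (D z t * \<gamma> t) \<partial>U)"
      by (intro nn_integral_cong)
        (simp add: D_def abs_mult \<gamma>_nonneg flip: left_diff_distrib)
    finally show "ennreal \<bar>(\<integral>w. F (cnj w * z) * G w \<partial>circle_measure)
        - (\<Sum>k\<le>N. c k * F (cnj (cis (2 * pi * (k / N))) * z))\<bar>
      \<le> (\<integral>\<^sup>+t. ennreal (D z t * \<gamma> t) \<partial>U)" .
  qed
  \<comment> \<open>With the order exchanged, the inner integral compares two rotations of
    \<open>F\<close> by angles closer than \<open>\<delta>\<close>. It is below \<open>e\<close>
    uniformly in \<open>t\<close>, so \<open>\<gamma>\<close> enters only through its
    integral.\<close>
  also have "\<dots> = (\<integral>\<^sup>+t. \<integral>\<^sup>+z. ennreal (D z t * \<gamma> t) \<partial>circle_measure \<partial>U)"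
    by (rule UC.Fubini'[symmetric]) measurable
  also have "\<dots> \<le> (\<integral>\<^sup>+t. ennreal e * ennreal (\<gamma> t) \<partial>U)"
  proof (rule nn_integral_mono_AE, use AE_U in eventually_elim)
    case (elim t)
    have "(\<integral>\<^sup>+z. ennreal (D z t * \<gamma> t) \<partial>circle_measure)
        = (\<integral>\<^sup>+z. ennreal (D z t) \<partial>circle_measure) * ennreal (\<gamma> t)"
      by (subst nn_integral_multc[symmetric])
        (measurable, auto simp: D_def \<gamma>_nonneg ennreal_mult U_def)
    also have "\<dots> \<le> ennreal e * ennreal (\<gamma> t)"
      unfolding D_def using close[OF \<kappa>_close[OF elim]] by (intro mult_right_mono) auto
    finally show ?case .
  qed
  also have "\<dots> = ennreal e * ennreal (\<integral>w. G w \<partial>circle_measure)"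
    by (simp add: nn_integral_cmult nn_integral_eq_integral[OF int_\<gamma>] \<gamma>_nonneg integral_\<gamma>)
  finally show ?thesis
    using c_nonneg sum_c by (intro exI[of _ N] exI[of _ c] conjI allI)
qed

lemma Linfty_rotate:
  fixes F :: "complex \<Rightarrow> real"
  assumes [measurable]: "F \<in> borel_measurable circle_measure"
    and F: "\<And>z. z \<in> sphere 0 1 \<Longrightarrow> \<bar>F z\<bar> \<le> M" and w: "w \<in> sphere 0 1"
  shows "(\<lambda>z. complex_of_real (F (cnj w * z))) \<in> Linfty"
proof (rule LinftyI[where C = M])
  have [measurable]: "w \<in> space circle_measure"
    using w by (simp add: space_circle_measure)
  show "(\<lambda>z. complex_of_real (F (cnj w * z))) \<in> borel_measurable circle_measure"
    by measurable
  show "AE z in circle_measure. norm (complex_of_real (F (cnj w * z))) \<le> M"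
    using F w by (intro AE_I2) (auto simp: space_circle_measure norm_mult)
qed

lemma Linfty_sum:
  "(\<And>i. i \<in> I \<Longrightarrow> u i \<in> Linfty) \<Longrightarrow> (\<lambda>z. \<Sum>i\<in>I. u i z) \<in> Linfty"
  by (induction I rule: infinite_finite_induct) (auto intro: Linfty_add LinftyI[where C = 0])

section \<open>The norm inequality and almost everywhere existence\<close>

context continuous_rotationally_symmetric_norm
begin

lemma sum_le: "(\<And>i. i \<in> I \<Longrightarrow> u i \<in> Linfty) \<Longrightarrow> \<alpha> (\<lambda>z. \<Sum>i\<in>I. u i z) \<le> (\<Sum>i\<in>I. \<alpha> (u i))"
proof (induction I rule: infinite_finite_induct)
  case (insert i I)
  have "\<alpha> (\<lambda>z. u i z + (\<Sum>i\<in>I. u i z)) \<le> \<alpha> (u i) + \<alpha> (\<lambda>z. \<Sum>i\<in>I. u i z)"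
    by (intro triangle Linfty_sum insert.prems) auto
  then show ?case
    using insert by force
qed (auto simp: zero)

text \<open>Nonnegative weights with total \<open>I\<close> give the Riemann sums the same bound
  \<open>M * I\<close> as the convolution itself. This is the uniform bound that
  \<open>le_of_L1_limit\<close> demands.\<close>

lemma bounded_convolution_le:
  fixes F G :: "complex \<Rightarrow> real"
  assumes [measurable]: "F \<in> borel_measurable circle_measure"
    and F: "\<And>z. z \<in> sphere 0 1 \<Longrightarrow> 0 \<le> F z \<and> F z \<le> M"
    and G: "integrable circle_measure G" "\<And>w. 0 \<le> G w"
  shows "\<alpha> (\<lambda>z. complex_of_real (\<integral>w. F (cnj w * z) * G w \<partial>circle_measure))
    \<le> \<alpha> (\<lambda>z. complex_of_real (F z)) * (\<integral>w. G w \<partial>circle_measure)"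
proof -
  define I where "I = (\<integral>w. G w \<partial>circle_measure)"
  define K where "K z = (\<integral>w. F (cnj w * z) * G w \<partial>circle_measure)" for z
  have [measurable]: "G \<in> borel_measurable circle_measure"
    using G by auto
  have F_abs: "\<bar>F z\<bar> \<le> M" if "z \<in> sphere 0 1" for z
    using F[OF that] by auto
  define close_sum where "close_sum n N c \<longleftrightarrow> (\<forall>k. 0 \<le> c k) \<and> (\<Sum>k\<le>N. c k) = I \<and>
    (\<integral>\<^sup>+z. ennreal \<bar>K z - (\<Sum>k\<le>N. c k * F (cnj (cis (2 * pi * (real k / real N))) * z))\<bar> \<partial>circle_measure)
      \<le> ennreal (inverse (Suc n)) * ennreal I" for n N :: nat and c :: "nat \<Rightarrow> real"
  have "\<exists>N c. close_sum n N c" for n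
    unfolding close_sum_def I_def K_def by (rule convolution_Riemann_sum[OF assms]) simp_all
  then obtain N :: "nat \<Rightarrow> nat" and c :: "nat \<Rightarrow> nat \<Rightarrow> real" where "\<And>n. close_sum n (N n) (c n)"
    by metis
  then have c: "\<And>n k. 0 \<le> c n k" "\<And>n. (\<Sum>k\<le>N n. c n k) = I"
    and close: "\<And>n. (\<integral>\<^sup>+z. ennreal \<bar>K z - (\<Sum>k\<le>N n. c n k * F (cnj (cis (2 * pi * (real k / real (N n)))) * z))\<bar>
      \<partial>circle_measure) \<le> ennreal (inverse (Suc n)) * ennreal I"
    unfolding close_sum_def by blast+
  define w where "w n k = cis (2 * pi * (real k / real (N n)))" for n k
  have w: "w n k \<in> sphere 0 1" for n k
    by (simp add: w_def)
  have [measurable]: "w n k \<in> space circle_measure" for n k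
    using w by (simp add: space_circle_measure)
  have rot_Linfty: "(\<lambda>z. complex_of_real (F (cnj (w n k) * z))) \<in> Linfty" for n k
    by (rule Linfty_rotate[OF assms(1) F_abs w])
  have F_Linfty: "(\<lambda>z. complex_of_real (F z)) \<in> Linfty"
    using F by (intro LinftyI[where C = M] AE_I2) (auto simp: space_circle_measure)
  have rot_norm: "\<alpha> (\<lambda>z. complex_of_real (F (cnj (w n k) * z))) = \<alpha> (\<lambda>z. complex_of_real (F z))" for n k
    using rotate[OF F_Linfty w[of n k]] by (simp add: rotate_fun_def)
  define R where "R n z = (\<Sum>k\<le>N n. c n k * F (cnj (w n k) * z))" for n z
  have [measurable]: "R n \<in> borel_measurable circle_measure" for n
    unfolding R_def by measurable
  have [measurable]: "K \<in> borel_measurable circle_measure"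
    unfolding K_def by measurable
  have "\<alpha> (\<lambda>z. complex_of_real (K z)) \<le> \<alpha> (\<lambda>z. complex_of_real (F z)) * I"
  proof (rule le_of_L1_limit)
    show "AE z in circle_measure. norm (complex_of_real (R n z)) \<le> M * I" for n
    proof (rule AE_I2)
      fix z assume "z \<in> space circle_measure"
      then have Fw: "\<bar>F (cnj (w n k) * z)\<bar> \<le> M" for k
        using w[of n k] by (intro F_abs) (simp add: space_circle_measure norm_mult)
      have "\<bar>R n z\<bar> \<le> (\<Sum>k\<le>N n. c n k * M)"
        unfolding R_def using c Fw
        by (intro order.trans[OF sum_abs] sum_mono) (auto simp: abs_mult intro!: mult_left_mono)
      also have "\<dots> = M * I"
        by (simp only: sum_distrib_right[symmetric] c mult.commute[of I])
      finally show "norm (complex_of_real (R n z)) \<le> M * I"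
        by simp
    qed
    show "AE z in circle_measure. norm (complex_of_real (K z)) \<le> M * I"
      using bounded_convolution_kernel(2,3)[OF assms] unfolding K_def I_def
      by (intro AE_I2) (simp add: space_circle_measure)
    have "(\<lambda>n. ennreal (inverse (Suc n)) * ennreal I) \<longlonglongrightarrow> ennreal 0 * ennreal I"
      by (intro tendsto_mult_ennreal tendsto_ennrealI LIMSEQ_inverse_real_of_nat tendsto_const) simp
    then have lim: "(\<lambda>n. ennreal (inverse (Suc n)) * ennreal I) \<longlonglongrightarrow> 0"
      by simp
    have close_R: "(\<integral>\<^sup>+z. ennreal \<bar>K z - R n z\<bar> \<partial>circle_measure)
        \<le> ennreal (inverse (Suc n)) * ennreal I" for n
      using close[of n] by (simp only: R_def w_def)
    have norm_diff: "norm (complex_of_real (K z) - complex_of_real (R n z)) = \<bar>K z - R n z\<bar>" for z n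
      by (metis norm_of_real of_real_diff)
    show "(\<lambda>n. \<integral>\<^sup>+z. norm (complex_of_real (K z) - complex_of_real (R n z)) \<partial>circle_measure) \<longlonglongrightarrow> 0"
      unfolding norm_diff
      by (rule tendsto_sandwich[OF _ _ tendsto_const lim])
        (intro always_eventually allI zero_le close_R)+
    show "\<alpha> (\<lambda>z. complex_of_real (R n z)) \<le> \<alpha> (\<lambda>z. complex_of_real (F z)) * I" for n
    proof -
      have "\<alpha> (\<lambda>z. complex_of_real (R n z))
          \<le> (\<Sum>k\<le>N n. \<alpha> (\<lambda>z. complex_of_real (c n k) * complex_of_real (F (cnj (w n k) * z))))"
        unfolding R_def of_real_sum of_real_mult by (intro sum_le Linfty_cmult rot_Linfty)
      also have "\<dots> = (\<Sum>k\<le>N n. c n k * \<alpha> (\<lambda>z. complex_of_real (F z)))"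
        using c by (intro sum.cong refl) (subst scale[OF rot_Linfty], simp add: rot_norm)
      also have "\<dots> = \<alpha> (\<lambda>z. complex_of_real (F z)) * I"
        by (simp only: sum_distrib_right[symmetric] c mult.commute[of I])
      finally show ?thesis .
    qed
  qed measurable
  then show ?thesis
    by (simp add: K_def I_def)
qed

text \<open>The bound passes from the truncations \<open>min F k\<close> to \<open>F\<close> by the Fatou property. Since \<open>s\<close>
  may also be a multiple of the indicator of the set where the convolution is infinite, this also
  yields its finiteness almost everywhere.\<close>

lemma dominated_by_convolution:
  fixes F G :: "complex \<Rightarrow> real"
  assumes [measurable]: "F \<in> borel_measurable circle_measure"
    and F: "\<And>z. 0 \<le> F z"
    and G: "integrable circle_measure G" "\<And>w. 0 \<le> G w"
    and s: "s \<in> Linfty" "AE z in circle_measure.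
      ennreal (norm (s z)) \<le> (\<integral>\<^sup>+w. ennreal (F (cnj w * z) * G w) \<partial>circle_measure)"
  shows "ennreal (\<alpha> s)
    \<le> ext_norm \<alpha> (\<lambda>z. complex_of_real (F z)) * ennreal (\<integral>w. G w \<partial>circle_measure)"
proof -
  have [measurable]: "G \<in> borel_measurable circle_measure"
    using G by auto
  define T where "T k z = min (F z) (real k)" for k z
  have [measurable]: "T k \<in> borel_measurable circle_measure" for k
    unfolding T_def by measurable
  have T: "0 \<le> T k z \<and> T k z \<le> real k" for k z
    using F by (auto simp: T_def)
  define h where "h k z = (\<integral>w. T k (cnj w * z) * G w \<partial>circle_measure)" for k z
  note kernel = bounded_convolution_kernel[of "T _", OF _ T G]
  have h_eq: "ennreal (h k z) = (\<integral>\<^sup>+w. ennreal (T k (cnj w * z) * G w) \<partial>circle_measure)"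
    if "z \<in> sphere 0 1" for k z
    unfolding h_def using T G by (intro nn_integral_eq_integral[symmetric] kernel(1) that) auto
  have T_mono: "T k z \<le> T l z" if "k \<le> l" for k l z
    using that by (auto simp: T_def)
  show ?thesis
  proof (rule Fatou[where h = h and M = "\<lambda>k. real k * (\<integral>w. G w \<partial>circle_measure)"])
    show "h k \<in> borel_measurable circle_measure" for k
      unfolding h_def by measurable
    show "0 \<le> h k z" "h k z \<le> real k * (\<integral>w. G w \<partial>circle_measure)" if "z \<in> sphere 0 1" for k z
      unfolding h_def using that by (intro kernel(2,3); simp)+
    show "incseq (\<lambda>k. h k z)" if "z \<in> sphere 0 1" for z
      unfolding incseq_def h_def using that
      by (intro allI impI integral_mono kernel(1) mult_right_mono T_mono G) auto
    show "ennreal (\<alpha> (\<lambda>z. complex_of_real (h k z)))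
        \<le> ext_norm \<alpha> (\<lambda>z. complex_of_real (F z)) * ennreal (\<integral>w. G w \<partial>circle_measure)" for k
    proof -
      have T_Linfty: "(\<lambda>z. complex_of_real (T k z)) \<in> Linfty"
        using T by (intro LinftyI[where C = "real k"] AE_I2) auto
      have "ennreal (\<alpha> (\<lambda>z. complex_of_real (h k z)))
          \<le> ennreal (\<alpha> (\<lambda>z. complex_of_real (T k z)) * (\<integral>w. G w \<partial>circle_measure))"
        unfolding h_def by (intro ennreal_leI bounded_convolution_le[OF _ T G]) auto
      also have "\<dots> = ennreal (\<alpha> (\<lambda>z. complex_of_real (T k z))) * ennreal (\<integral>w. G w \<partial>circle_measure)"
        by (intro ennreal_mult nonneg T_Linfty Bochner_Integration.integral_nonneg G)
      also have "\<dots> \<le> ext_norm \<alpha> (\<lambda>z. complex_of_real (F z)) * ennreal (\<integral>w. G w \<partial>circle_measure)"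
        using F by (intro mult_right_mono le_ext_norm T_Linfty AE_I2) (auto simp: T_def)
      finally show ?thesis .
    qed
    show "AE z in circle_measure. ennreal (norm (s z)) \<le> (SUP k. ennreal (h k z))"
      using s(2) AE_space
    proof eventually_elim
      case (elim z)
      note elim(2) [measurable]
      have z: "z \<in> sphere 0 1"
        using elim by (simp add: space_circle_measure)
      \<comment> \<open>The supremum is attained, at any natural number not below
        \<open>F y\<close>.\<close>
      have "(SUP k. ennreal (T k y * G w)) = ennreal (F y * G w)" for y w
      proof (rule antisym)
        show "(SUP k. ennreal (T k y * G w)) \<le> ennreal (F y * G w)"
          by (intro SUP_least ennreal_leI mult_right_mono G) (simp add: T_def)
        have "F y \<le> real (nat \<lceil>F y\<rceil>)"
          by linarith
        then have "ennreal (F y * G w) = ennreal (T (nat \<lceil>F y\<rceil>) y * G w)"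
          by (simp add: T_def min_absorb1)
        then show "ennreal (F y * G w) \<le> (SUP k. ennreal (T k y * G w))"
          by (metis SUP_upper UNIV_I)
      qed
      then have "(\<integral>\<^sup>+w. ennreal (F (cnj w * z) * G w) \<partial>circle_measure)
          = (\<integral>\<^sup>+w. (SUP k. ennreal (T k (cnj w * z) * G w)) \<partial>circle_measure)"
        by simp
      also have "\<dots> = (SUP k. \<integral>\<^sup>+w. ennreal (T k (cnj w * z) * G w) \<partial>circle_measure)"
        by (rule nn_integral_monotone_convergence_SUP)
          (auto simp: incseq_def le_fun_def intro!: ennreal_leI mult_right_mono T_mono G)
      finally show ?case
        using elim(1) by (simp add: h_eq[OF z])
    qed
  qed fact
qed

lemma ext_norm_vec_convolution_le:
  fixes f :: "complex \<Rightarrow> 'x::{complex_banach, second_countable_topology}"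
  assumes [measurable]: "f \<in> borel_measurable circle_measure" and g: "integrable circle_measure g"
  shows "ext_norm_vec \<alpha> (convolution f g)
    \<le> ext_norm_vec \<alpha> f * ennreal (\<integral>w. norm (g w) \<partial>circle_measure)"
  unfolding ext_norm_vec_def
proof (rule ext_norm_le)
  fix s assume s: "s \<in> Linfty"
    "AE z in circle_measure. norm (s z) \<le> norm (abs_fun (convolution f g) z)"
  have "ennreal (norm (convolution f g z))
      \<le> (\<integral>\<^sup>+w. ennreal (norm (f (cnj w * z)) * norm (g w)) \<partial>circle_measure)" for z
    unfolding convolution_def norm_convolution_integrand[symmetric]
    by (rule norm_integral_le_nn_integral)
  then have "AE z in circle_measure. ennreal (norm (s z))
      \<le> (\<integral>\<^sup>+w. ennreal (norm (f (cnj w * z)) * norm (g w)) \<partial>circle_measure)"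
    using s(2) by (auto elim!: eventually_mono simp: abs_fun_def intro: order_trans ennreal_leI)
  then show "ennreal (\<alpha> s) \<le> ext_norm \<alpha> (abs_fun f) * ennreal (\<integral>w. norm (g w) \<partial>circle_measure)"
    unfolding abs_fun_def using g by (intro dominated_by_convolution s) auto
qed

text \<open>The integrand is integrable where the scalar integral \<open>H\<close> is finite, so it
  remains to see that \<open>E\<close> is null. Definiteness of \<open>\<alpha>\<close> reduces this
  to showing that the indicator of \<open>E\<close> has norm 0.\<close>

lemma AE_integrable_convolution_integrand:
  fixes f :: "complex \<Rightarrow> 'x::{complex_banach, second_countable_topology}"
  assumes [measurable]: "f \<in> borel_measurable circle_measure" and g: "integrable circle_measure g"
    and finite: "ext_norm_vec \<alpha> f < \<infinity>"
  shows "AE z in circle_measure. integrable circle_measure (convolution_integrand f g z)"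
proof -
  have [measurable]: "g \<in> borel_measurable circle_measure"
    using g by auto
  define H where "H z = (\<integral>\<^sup>+w. ennreal (norm (f (cnj w * z)) * norm (g w)) \<partial>circle_measure)" for z
  have [measurable]: "H \<in> borel_measurable circle_measure"
    unfolding H_def by measurable
  define E where "E = {z \<in> space circle_measure. H z = \<infinity>}"
  have [measurable]: "E \<in> sets circle_measure"
    unfolding E_def by measurable
  have ind: "indicator E \<in> Linfty"
    by (rule LinftyI[where C = 1]) (auto simp: indicator_def)
  \<comment> \<open>Both factors are finite, so \<open>enn2real\<close> loses nothing.\<close>
  define C where "C = enn2real (ext_norm_vec \<alpha> f * ennreal (\<integral>w. norm (g w) \<partial>circle_measure))"
  \<comment> \<open>\<open>H\<close> is infinite on \<open>E\<close> and so dominates every multiple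
    of the indicator. As \<open>C\<close> does not depend on \<open>n\<close>, the norm of the
    indicator must vanish.\<close>
  have "real n * \<alpha> (indicator E) \<le> C" for n
  proof -
    have "ennreal (\<alpha> (\<lambda>z. complex_of_real (real n) * indicator E z))
        \<le> ext_norm \<alpha> (\<lambda>z. complex_of_real (norm (f z))) * ennreal (\<integral>w. norm (g w) \<partial>circle_measure)"
    proof (rule dominated_by_convolution)
      show "(\<lambda>z. complex_of_real (real n) * indicator E z) \<in> Linfty"
        by (rule Linfty_cmult[OF ind])
      show "AE z in circle_measure. ennreal (norm (complex_of_real (real n) * indicator E z))
          \<le> (\<integral>\<^sup>+w. ennreal (norm (f (cnj w * z)) * norm (g w)) \<partial>circle_measure)"
        unfolding H_def[symmetric] by (rule AE_I2) (auto simp: indicator_def E_def)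
    qed (use g in auto)
    also have "\<dots> = ennreal C"
      using finite unfolding C_def ext_norm_vec_def abs_fun_def
      by (intro ennreal_enn2real[symmetric]) (auto simp: ennreal_mult_less_top)
    finally show ?thesis
      using scale[OF ind, of "complex_of_real (real n)"] by (simp add: C_def)
  qed
  then have "\<alpha> (indicator E) \<le> 0"
    using ex_less_of_nat_mult[of "\<alpha> (indicator E)" C] by (meson not_le)
  then have "\<alpha> (indicator E) = 0"
    using nonneg[OF ind] by simp
  from eq_zero[OF ind this] show ?thesis
    using AE_space
  proof eventually_elim
    case (elim z)
    note elim(2) [measurable]
    have "H z < \<infinity>"
      using elim by (simp add: E_def indicator_def less_top split: if_splits)
    then show ?case
      unfolding H_def norm_convolution_integrand[symmetric] by (intro integrableI_bounded) measurable
  qed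
qed

section \<open>Membership in the closure of the bounded functions\<close>

text \<open>Where \<open>|f| > 2 M\<close> and \<open>|h| \<le> M\<close>, the modulus of \<open>|f| - h\<close> exceeds \<open>|f| / 2\<close>.\<close>

lemma L_alpha_vec_truncation:
  fixes f :: "complex \<Rightarrow> 'x::{real_normed_vector, second_countable_topology}"
  assumes f: "f \<in> L_alpha_vec \<alpha>" and "0 < e"
  shows "\<exists>B. ext_norm_vec \<alpha> (\<lambda>z. if norm (f z) \<le> B then 0 else f z) \<le> ennreal e"
proof -
  have "abs_fun f \<in> L_alpha \<alpha>"
    using f by (simp add: L_alpha_vec_def)
  moreover have "0 < ennreal (e / 2)"
    using \<open>0 < e\<close> by simp
  ultimately obtain h where "h \<in> Linfty" and h: "ext_norm \<alpha> (\<lambda>z. abs_fun f z - h z) < ennreal (e / 2)"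
    unfolding L_alpha_def by blast
  obtain M where M: "AE z in circle_measure. norm (h z) \<le> M"
    using \<open>h \<in> Linfty\<close> by (rule LinftyE)
  have "ext_norm_vec \<alpha> (\<lambda>z. if norm (f z) \<le> 2 * M then 0 else f z)
      \<le> ext_norm \<alpha> (\<lambda>z. complex_of_real 2 * (abs_fun f z - h z))"
    unfolding ext_norm_vec_def
  proof (rule ext_norm_mono, use M in eventually_elim)
    case (elim z)
    have "norm (f z) - norm (h z) \<le> norm (abs_fun f z - h z)"
      using norm_triangle_ineq2[of "abs_fun f z" "h z"] by (simp add: abs_fun_def)
    then have "norm (f z) \<le> 2 * norm (abs_fun f z - h z)" if "2 * M < norm (f z)"
      using elim that by linarith
    moreover have "norm (complex_of_real 2 * (abs_fun f z - h z)) = 2 * norm (abs_fun f z - h z)"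
      by (simp only: norm_mult norm_of_real)
    moreover have "norm (abs_fun (\<lambda>z. if norm (f z) \<le> 2 * M then 0 else f z) z)
        = (if norm (f z) \<le> 2 * M then 0 else norm (f z))"
      by (simp add: abs_fun_def)
    ultimately show ?case
      by (simp only: not_le split: if_split) simp
  qed
  also have "\<dots> \<le> ennreal 2 * ext_norm \<alpha> (\<lambda>z. abs_fun f z - h z)"
    by (rule ext_norm_cmult_le) simp
  also have "\<dots> \<le> ennreal 2 * ennreal (e / 2)"
    using h by (intro mult_left_mono) auto
  also have "\<dots> = ennreal e"
    using \<open>0 < e\<close> by (subst ennreal_mult[symmetric]) auto
  finally show ?thesis ..
qed

text \<open>The uniform bound of \<open>f\<close> comes out of the integral at every point. Applied
  to the bounded part of a function, this provides the approximant in \<open>Linfty\<close>.\<close>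

lemma convolution_bounded:
  fixes f :: "complex \<Rightarrow> 'x::{complex_banach, second_countable_topology}"
  assumes [measurable]: "f \<in> borel_measurable circle_measure" and g: "integrable circle_measure g"
    and f: "\<And>z. norm (f z) \<le> B"
  shows "abs_fun (convolution f g) \<in> Linfty"
proof (rule LinftyI[where C = "B * (\<integral>w. norm (g w) \<partial>circle_measure)"])
  have [measurable]: "g \<in> borel_measurable circle_measure"
    using g by auto
  note measurable_convolution [measurable]
  show "abs_fun (convolution f g) \<in> borel_measurable circle_measure"
    unfolding abs_fun_def by measurable
  have "norm (convolution f g z) \<le> B * (\<integral>w. norm (g w) \<partial>circle_measure)" for z
  proof -
    have "0 \<le> B"
      using f[of z] norm_ge_zero[of "f z"] by linarith
    have "ennreal (norm (convolution f g z))
        \<le> (\<integral>\<^sup>+w. ennreal (norm (f (cnj w * z)) * norm (g w)) \<partial>circle_measure)"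
      unfolding convolution_def norm_convolution_integrand[symmetric]
      by (rule norm_integral_le_nn_integral)
    also have "\<dots> \<le> (\<integral>\<^sup>+w. ennreal (B * norm (g w)) \<partial>circle_measure)"
      by (intro nn_integral_mono ennreal_leI mult_right_mono f) auto
    also have "\<dots> = ennreal (\<integral>w. B * norm (g w) \<partial>circle_measure)"
      using g \<open>0 \<le> B\<close> by (intro nn_integral_eq_integral) auto
    finally show ?thesis
      using \<open>0 \<le> B\<close> by (subst (asm) ennreal_le_iff) auto
  qed
  then show "AE z in circle_measure. norm (abs_fun (convolution f g) z)
      \<le> B * (\<integral>w. norm (g w) \<partial>circle_measure)"
    by (simp add: abs_fun_def)
qed

text \<open>The approximant is the modulus of \<open>convolution f1 g\<close>, where
  \<open>f1\<close> is the bounded part of \<open>f\<close>. By the reverse triangle inequality its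
  distance from the modulus of \<open>convolution f g\<close> is at most the modulus of
  \<open>convolution f2 g\<close> almost everywhere, and the norm inequality makes that
  small.\<close>

lemma convolution_in_L_alpha_vec:
  fixes f :: "complex \<Rightarrow> 'x::{complex_banach, second_countable_topology}"
  assumes f: "f \<in> L_alpha_vec \<alpha>" and g: "integrable circle_measure g"
  shows "convolution f g \<in> L_alpha_vec \<alpha>"
proof -
  have f_meas [measurable]: "f \<in> borel_measurable circle_measure" and "ext_norm_vec \<alpha> f < \<infinity>"
    using f by (auto simp: L_alpha_vec_def L_alpha_def calL_alpha_def ext_norm_vec_def)
  have [measurable]: "g \<in> borel_measurable circle_measure"
    using g by auto
  have conv_meas [measurable]: "convolution f g \<in> borel_measurable circle_measure"
    by (rule measurable_convolution) measurable
  define I where "I = (\<integral>w. norm (g w) \<partial>circle_measure)"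
  have "0 \<le> I"
    by (simp add: I_def)
  have "ext_norm_vec \<alpha> (convolution f g) < \<infinity>"
    using ext_norm_vec_convolution_le[OF f_meas g] \<open>ext_norm_vec \<alpha> f < \<infinity>\<close>
    by (auto simp: ennreal_mult_less_top elim!: order.strict_trans1)
  then have "abs_fun (convolution f g) \<in> calL_alpha \<alpha>"
    unfolding calL_alpha_def ext_norm_vec_def by (simp add: abs_fun_def)
  moreover have "\<exists>h\<in>Linfty. ext_norm \<alpha> (\<lambda>z. abs_fun (convolution f g) z - h z) < \<epsilon>" if "0 < \<epsilon>" for \<epsilon>
  proof -
    \<comment> \<open>\<open>\<epsilon>\<close> ranges over \<open>ennreal\<close> and may be
      infinite; a positive real below it is extracted.\<close>
    obtain x where "0 < x" "x < \<epsilon>"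
      using \<open>0 < \<epsilon>\<close> dense by blast
    then obtain e where "0 < e" and e: "ennreal e < \<epsilon>"
      by (cases x) (auto simp: top_unique)
    \<comment> \<open>Adding 1 avoids division by zero when \<open>g\<close> vanishes almost
      everywhere, and \<open>e / (I + 1) * I \<le> e\<close> still holds.\<close>
    have "0 < e / (I + 1)"
      using \<open>0 < e\<close> \<open>0 \<le> I\<close> by simp
    from L_alpha_vec_truncation[OF f this] obtain B
      where B: "ext_norm_vec \<alpha> (\<lambda>z. if norm (f z) \<le> B then 0 else f z) \<le> ennreal (e / (I + 1))"
      by blast
    define f1 where "f1 z = (if norm (f z) \<le> B then f z else 0)" for z
    define f2 where "f2 z = (if norm (f z) \<le> B then 0 else f z)" for z
    have f1 [measurable]: "f1 \<in> borel_measurable circle_measure"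
      unfolding f1_def by measurable
    have f2 [measurable]: "f2 \<in> borel_measurable circle_measure"
      unfolding f2_def by measurable
    have "ext_norm_vec \<alpha> f1 \<le> ext_norm_vec \<alpha> f" "ext_norm_vec \<alpha> f2 \<le> ext_norm_vec \<alpha> f"
      unfolding ext_norm_vec_def by (rule ext_norm_mono, simp add: abs_fun_def f1_def f2_def)+
    then have finite: "ext_norm_vec \<alpha> f1 < \<infinity>" "ext_norm_vec \<alpha> f2 < \<infinity>"
      using \<open>ext_norm_vec \<alpha> f < \<infinity>\<close> by (auto elim: order.strict_trans1)
    have split: "convolution_integrand f g z w
        = convolution_integrand f1 g z w + convolution_integrand f2 g z w" for z w
      by (simp add: convolution_integrand_def f1_def f2_def flip: scaleC_add_right)
    \<comment> \<open>Additivity of the Bochner integral requires both pieces to be integrable;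
      where one is not, the default value 0 could break the identity.\<close>
    have "AE z in circle_measure. convolution f g z = convolution f1 g z + convolution f2 g z"
      using AE_integrable_convolution_integrand[OF f1 g finite(1)]
        AE_integrable_convolution_integrand[OF f2 g finite(2)]
      by eventually_elim (simp add: convolution_def split)
    then have "ext_norm \<alpha> (\<lambda>z. abs_fun (convolution f g) z - abs_fun (convolution f1 g) z)
        \<le> ext_norm_vec \<alpha> (convolution f2 g)"
      unfolding ext_norm_vec_def
    proof (intro ext_norm_mono, eventually_elim)
      case (elim z)
      have "norm (abs_fun (convolution f g) z - abs_fun (convolution f1 g) z)
          = \<bar>norm (convolution f g z) - norm (convolution f1 g z)\<bar>"
        unfolding abs_fun_def by (metis norm_of_real of_real_diff)
      also have "\<dots> \<le> norm (convolution f g z - convolution f1 g z)"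
        by (rule norm_triangle_ineq3)
      finally show ?case
        by (simp add: elim abs_fun_def)
    qed
    also have "\<dots> \<le> ext_norm_vec \<alpha> f2 * ennreal I"
      unfolding I_def by (rule ext_norm_vec_convolution_le[OF f2 g])
    also have "\<dots> \<le> ennreal (e / (I + 1)) * ennreal I"
      using B by (intro mult_right_mono) (simp_all add: f2_def[abs_def])
    also have "\<dots> = ennreal (e / (I + 1) * I)"
      using \<open>0 < e\<close> \<open>0 \<le> I\<close> by (intro ennreal_mult[symmetric]) auto
    also have "\<dots> \<le> ennreal e"
      using \<open>0 < e\<close> \<open>0 \<le> I\<close> by (intro ennreal_leI) (simp add: field_simps)
    also note e
    finally have *: "ext_norm \<alpha> (\<lambda>z. abs_fun (convolution f g) z - abs_fun (convolution f1 g) z) < \<epsilon>" .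
    \<comment> \<open>\<open>B\<close> may be negative, in which case \<open>f1\<close> is
      identically 0.\<close>
    have "norm (f1 z) \<le> max B 0" for z
      by (auto simp: f1_def le_max_iff_disj)
    from convolution_bounded[OF f1 g this] show ?thesis
      using * by blast
  qed
  ultimately show ?thesis
    by (simp add: L_alpha_vec_def L_alpha_def)
qed

end

theorem theorem5p3:
  fixes \<alpha> :: "(complex \<Rightarrow> complex) \<Rightarrow> real"
    and f :: "complex \<Rightarrow> 'x::{complex_banach, second_countable_topology}"
    and g :: "complex \<Rightarrow> complex"
  assumes "continuous_rotationally_symmetric_norm \<alpha>"
    and "f \<in> L_alpha_vec \<alpha>"
    and "integrable circle_measure g"
  shows "(AE z in circle_measure. integrable circle_measure (convolution_integrand f g z))
    \<and> convolution f g \<in> L_alpha_vec \<alpha>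
    \<and> ext_norm_vec \<alpha> (convolution f g)
        \<le> ext_norm_vec \<alpha> f * ennreal (\<integral>w. norm (g w) \<partial>circle_measure)"
proof -
  interpret continuous_rotationally_symmetric_norm \<alpha> by fact
  have f: "f \<in> borel_measurable circle_measure" "ext_norm_vec \<alpha> f < \<infinity>"
    using assms(2) by (auto simp: L_alpha_vec_def L_alpha_def calL_alpha_def ext_norm_vec_def)
  show ?thesis
    using AE_integrable_convolution_integrand[OF f(1) assms(3) f(2)]
      convolution_in_L_alpha_vec[OF assms(2,3)] ext_norm_vec_convolution_le[OF f(1) assms(3)]
    by blast
qed

end
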